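(* Let $\beta\in(0,1)$ with $\beta\le1/2$. For every $N\in\mathbb{N}$ let $(A_N,B_N)$ be a solution of $$\min\{P(A,B)\colon A,B\subset\mathbb{Z}^2,\ A\cap B=\emptyset,\ \#A=\#B=N\}.$$ Then there exist isometries $T_N$ of $\mathbb{Z}^2$ such that $$\mu_{T_NA_N}\stackrel{\ast}{\rightharpoonup}\mathcal{L}|_{\mathcal{A}}\quad\text{and}\quad\mu_{T_NB_N}\stackrel{\ast}{\rightharpoonup}\mathcal{L}|_{\mathcal{B}}\qquad\text{as }N\to\infty,$$ where $\stackrel{\ast}{\rightharpoonup}$ denotes weak-$\ast$ convergence of measures and $$\mathcal{A}=\Big(-\sqrt{\tfrac{2-\beta}{2}},0\Big)\times\Big(0,\sqrt{\tfrac{2}{2-\beta}}\Big),\qquad \mathcal{B}=\Big(0,\sqrt{\tfrac{2-\beta}{2}}\Big)\times\Big(0,\sqrt{\tfrac{2}{2-\beta}}\Big).$$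
   Context: $\mathbb{N}=\{1,2,\dots\}$. For disjoint $C,D\subset\mathbb{Z}^2$, $Q(C,D)=\#\{(c,d)\in C\times D\colon|c-d|=1\}$ with $|\cdot|$ the Euclidean norm, and for disjoint finite $A,B\subset\mathbb{Z}^2$, $P(A,B)=Q(A,A^c)+Q(B,B^c)-2\beta Q(A,B)$ (complements in $\mathbb{Z}^2$). For $V=\{x_1,\dots,x_N\}\subset\mathbb{Z}^2$ with $\#V=N$, the empirical measure on $\mathbb{R}^2$ is $\mu_V=\frac1N\sum_{i=1}^N\delta_{x_i/\sqrt N}$. $\mathcal{L}$ is the two-dimensional Lebesgue measure and $\mathcal{L}|_{\mathcal{A}}$ its restriction to $\mathcal{A}$. An isometry of $\mathbb{Z}^2$ is a composition of translations by vectors of $\mathbb{Z}^2$, the rotation $(x_1,x_2)\mapsto(-x_2,x_1)$, and the reflections $(x_1,x_2)\mapsto(x_1,-x_2)$, $(x_1,x_2)\mapsto(-x_1,x_2)$. *)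

theory Defs
  imports "HOL-Analysis.Analysis"
begin

type_synonym lattice = "int \<times> int"

definition lattice_embed :: "lattice \<Rightarrow> real \<times> real" where
  "lattice_embed x = (real_of_int (fst x), real_of_int (snd x))"

text \<open>Here \<open>norm\<close> is the product norm on \<open>real \<times> real\<close>, i.e. the Euclidean norm.
  The set being counted is finite as soon as one of \<open>C\<close>, \<open>D\<close> is finite, which is the case in
  every use below, although the other set may be a complement.\<close>

definition Q :: "lattice set \<Rightarrow> lattice set \<Rightarrow> nat" where
  "Q C D = card {(c, d). c \<in> C \<and> d \<in> D \<and> norm (lattice_embed c - lattice_embed d) = 1}"

definition P :: "real \<Rightarrow> lattice set \<Rightarrow> lattice set \<Rightarrow> real" where
  "P \<beta> A B = real (Q A (- A)) + real (Q B (- B)) - 2 * \<beta> * real (Q A B)"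

definition admissible :: "nat \<Rightarrow> lattice set \<Rightarrow> lattice set \<Rightarrow> bool" where
  "admissible N A B \<longleftrightarrow>
     A \<inter> B = {} \<and> finite A \<and> finite B \<and> card A = N \<and> card B = N"

definition double_bubble_solution :: "real \<Rightarrow> nat \<Rightarrow> lattice set \<Rightarrow> lattice set \<Rightarrow> bool" where
  "double_bubble_solution \<beta> N A B \<longleftrightarrow>
     is_arg_min (\<lambda>(A, B). P \<beta> A B) (\<lambda>(A, B). admissible N A B) (A, B)"

text \<open>The identity is the translation by \<open>0\<close>.\<close>

inductive_set lattice_isometries :: "(lattice \<Rightarrow> lattice) set" where
  translation: "(\<lambda>x. x + v) \<in> lattice_isometries"
| rotation: "(\<lambda>(x1, x2). (- x2, x1)) \<in> lattice_isometries"
| reflection1: "(\<lambda>(x1, x2). (x1, - x2)) \<in> lattice_isometries"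
| reflection2: "(\<lambda>(x1, x2). (- x1, x2)) \<in> lattice_isometries"
| comp: "S \<in> lattice_isometries \<Longrightarrow> T \<in> lattice_isometries \<Longrightarrow> S \<circ> T \<in> lattice_isometries"

text \<open>The image of the normalised counting measure on \<open>V\<close> under the rescaling by
  \<open>1 / sqrt (card V)\<close>; the lemma below identifies it with the normalised sum of Dirac masses.\<close>

definition empirical_measure :: "lattice set \<Rightarrow> (real \<times> real) measure" where
  "empirical_measure V =
     distr (uniform_count_measure V) borel
       (\<lambda>x. lattice_embed x /\<^sub>R sqrt (real (card V)))"

lemma emeasure_empirical_measure:
  assumes "finite V" "E \<in> sets borel"
  shows "emeasure (empirical_measure V) E =
    ennreal (1 / real (card V) * (\<Sum>x\<in>V. indicator E (lattice_embed x /\<^sub>R sqrt (real (card V)))))"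
proof -
  let ?f = "\<lambda>x. lattice_embed x /\<^sub>R sqrt (real (card V))"
  have "?f \<in> uniform_count_measure V \<rightarrow>\<^sub>M borel"
    by (auto simp: measurable_def sets_uniform_count_measure space_uniform_count_measure)
  then have "emeasure (empirical_measure V) E
      = emeasure (uniform_count_measure V) (?f -` E \<inter> V)"
    unfolding empirical_measure_def
    using assms by (simp add: emeasure_distr space_uniform_count_measure)
  also have "\<dots> = ennreal (real (card (?f -` E \<inter> V)) / real (card V))"
    using assms by (simp add: emeasure_uniform_count_measure)
  also have "real (card (?f -` E \<inter> V)) = (\<Sum>x\<in>V. indicator E (?f x))"
    using assms by (simp add: indicator_def sum.If_cases vimage_def Int_def conj_commute)
  finally show ?thesis by simp
qed

text \<open>Weak-* convergence of finite Borel measures on the plane, as functionals on the space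
  \<open>C\<^sub>0\<close> of continuous functions vanishing at infinity.\<close>

definition weak_star_convergent ::
    "(nat \<Rightarrow> (real \<times> real) measure) \<Rightarrow> (real \<times> real) measure \<Rightarrow> bool" where
  "weak_star_convergent \<mu> \<nu> \<longleftrightarrow>
     (\<forall>f :: real \<times> real \<Rightarrow> real. continuous_on UNIV f \<longrightarrow> (f \<longlongrightarrow> 0) at_infinity \<longrightarrow>
        (\<lambda>N. integral\<^sup>L (\<mu> N) f) \<longlonglongrightarrow> integral\<^sup>L \<nu> f)"

text \<open>The restricted measure \<open>E \<mapsto> \<L>(E \<inter> S)\<close>, still a Borel measure on the whole plane
  (unlike \<open>restrict_space\<close>, which would shrink the underlying space to \<open>S\<close>).\<close>

definition lebesgue_restricted :: "(real \<times> real) set \<Rightarrow> (real \<times> real) measure" where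
  "lebesgue_restricted S = density lborel (indicator S)"

definition limit_A :: "real \<Rightarrow> (real \<times> real) set" where
  "limit_A \<beta> = {- sqrt ((2 - \<beta>) / 2) <..< 0} \<times> {0 <..< sqrt (2 / (2 - \<beta>))}"

definition limit_B :: "real \<Rightarrow> (real \<times> real) set" where
  "limit_B \<beta> = {0 <..< sqrt ((2 - \<beta>) / 2)} \<times> {0 <..< sqrt (2 / (2 - \<beta>))}"

end

theory Submission
  imports Defs
begin

text \<open>
  Cut a pair \<open>(A, B)\<close> of disjoint finite sets by all horizontal and vertical lattice lines.
  Bonds run along these lines, so \<open>P\<close> is the sum of the energies of the lines, and
  a line costs at least \<open>2\<close> if it meets only one of the two sets and at least
  \<open>4 - 2 * \<beta>\<close> if it meets both. Let \<open>w1\<close>, \<open>h1\<close> be the sizes of the two projections of \<open>A\<close>,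
  \<open>w2\<close>, \<open>h2\<close> those of \<open>B\<close>, and \<open>x\<close>, \<open>y\<close> the sizes of the intersections of the projections. Then
  \<open>P \<ge> 2 * (w1 + h1 + w2 + h2) - 2 * \<beta> * (x + y)\<close> (\<open>projection_bound_le_P\<close>), and counting points gives
  \<open>(w1 * h1) * (w2 * h2) \<ge> N\<^sup>2 + N * x * y\<close> (\<open>projections_product_ge\<close>).

  What remains is an optimisation in six real variables. The bound on \<open>P\<close> is twice
  \<open>S + T\<close> with \<open>S = w1 + w2 - \<beta> * x\<close> and \<open>T = h1 + h2 - \<beta> * y\<close>, and
  \<open>(S + T)\<^sup>2 = 4 * S * T + (S - T)\<^sup>2\<close>. With the relative overlaps \<open>X = 2 * x / (w1 + w2)\<close> and
  \<open>Y = 2 * y / (h1 + h2)\<close>, both in the unit interval, \<open>S * T / N\<close> is at least \<open>4 - 2 * \<beta>\<close> plus positive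
  multiples of \<open>(1 - X) * (1 - Y)\<close> and of \<open>X * Y\<close> (\<open>profile_inequality\<close>); this is where
  \<open>\<beta> \<le> 1 / 2\<close> enters. Two stacks of columns on either side of a vertical line have energy at most
  \<open>4 * sqrt ((4 - 2 * \<beta>) * N) + 8\<close> (\<open>P_solution_le\<close>), which is the lower bound up to a constant.
  Hence for minimisers \<open>X * Y\<close>, \<open>(1 - X) * (1 - Y)\<close> and \<open>(S - T) / sqrt N\<close> tend to \<open>0\<close>.
  If \<open>X \<le> Y\<close>, which a rotation by a right angle achieves, then \<open>X\<close> tends to \<open>0\<close> and \<open>Y\<close> to \<open>1\<close>, and all
  six numbers, divided by \<open>sqrt N\<close>, have the limits read off from the two limiting rectangles
  (\<open>profile_limits\<close>).

  The same bounds give the shape. The products \<open>w1 * h1\<close> and \<open>w2 * h2\<close> are asymptotic to \<open>N\<close>, so \<open>A\<close> and \<open>B\<close>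
  nearly fill the products of their projections. A line whose energy is not minimal wastes at least
  \<open>2 * \<beta>\<close>, so only \<open>o (sqrt N)\<close> lines are of this kind. Some row of minimal energy therefore nearly fills
  the first projections of both sets; on it \<open>A\<close> and \<open>B\<close> are adjacent intervals, so the first projections are
  nearly adjacent intervals. Likewise, a column of minimal energy that meets only \<open>A\<close> shows that the
  second projection of \<open>A\<close>, which nearly agrees with that of \<open>B\<close>, is nearly an interval
  (\<open>near_adjacent_rectangles\<close>). Moving the contact point to the origin leaves only \<open>o (N)\<close> points
  of either set outside its rectangle, which is enough for weak-* convergence
  (\<open>weak_star_convergent_of_cells\<close>).
\<close>

section \<open>The energy of one lattice line\<close>

definition contacts :: "int set \<Rightarrow> int set \<Rightarrow> nat" where
  "contacts S T = card {i \<in> S. i + 1 \<in> T} + card {i \<in> S. i - 1 \<in> T}"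

definition line_energy :: "real \<Rightarrow> int set \<Rightarrow> int set \<Rightarrow> real" where
  "line_energy \<beta> S T =
     real (contacts S (- S)) + real (contacts T (- T)) - 2 * \<beta> * real (contacts S T)"

text \<open>The energy of two disjoint nonempty intervals that touch, or of a single interval, according to which of
  the two sets are nonempty.\<close>

definition line_bound :: "real \<Rightarrow> int set \<Rightarrow> int set \<Rightarrow> real" where
  "line_bound \<beta> S T =
     2 * of_bool (S \<noteq> {}) + 2 * of_bool (T \<noteq> {}) - 2 * \<beta> * of_bool (S \<noteq> {} \<and> T \<noteq> {})"

lemma contacts_commute: "contacts S T = contacts T S"
proof -
  have "card {i \<in> S. i + 1 \<in> T} = card {i \<in> T. i - 1 \<in> S}" for S T :: "int set"
    by (rule bij_betw_same_card[of "\<lambda>i. i + 1"], rule bij_betw_byWitness[where f' = "\<lambda>i. i - 1"]) auto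
  then show ?thesis
    by (simp add: contacts_def)
qed

lemma contacts_empty [simp]: "contacts {} T = 0" "contacts S {} = 0"
  by (simp_all add: contacts_def)

lemma contacts_Un_right:
  assumes "finite S" "T \<inter> U = {}"
  shows "contacts S (T \<union> U) = contacts S T + contacts S U"
proof -
  have "{i \<in> S. i + 1 \<in> T \<union> U} = {i \<in> S. i + 1 \<in> T} \<union> {i \<in> S. i + 1 \<in> U}"
    "{i \<in> S. i - 1 \<in> T \<union> U} = {i \<in> S. i - 1 \<in> T} \<union> {i \<in> S. i - 1 \<in> U}"
    by auto
  moreover have "{i \<in> S. i + 1 \<in> T} \<inter> {i \<in> S. i + 1 \<in> U} = {}"
    "{i \<in> S. i - 1 \<in> T} \<inter> {i \<in> S. i - 1 \<in> U} = {}"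
    using assms by auto
  ultimately show ?thesis
    using assms by (simp add: contacts_def card_Un_disjoint)
qed

lemma contacts_Un_left:
  assumes "finite S" "finite T" "S \<inter> T = {}"
  shows "contacts (S \<union> T) U = contacts S U + contacts T U"
proof -
  have "{i \<in> S \<union> T. i + 1 \<in> U} = {i \<in> S. i + 1 \<in> U} \<union> {i \<in> T. i + 1 \<in> U}"
    "{i \<in> S \<union> T. i - 1 \<in> U} = {i \<in> S. i - 1 \<in> U} \<union> {i \<in> T. i - 1 \<in> U}"
    by auto
  moreover have "{i \<in> S. i + 1 \<in> U} \<inter> {i \<in> T. i + 1 \<in> U} = {}"
    "{i \<in> S. i - 1 \<in> U} \<inter> {i \<in> T. i - 1 \<in> U} = {}"
    using assms by auto
  ultimately show ?thesis
    using assms by (simp add: contacts_def card_Un_disjoint)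
qed

lemma contacts_Compl_ge_2:
  assumes "finite S" "S \<noteq> {}"
  shows "contacts S (- S) \<ge> 2"
proof -
  have "Max S \<in> {i \<in> S. i + 1 \<in> - S}" "Min S \<in> {i \<in> S. i - 1 \<in> - S}"
    using assms Max_ge[of S "Max S + 1"] Min_le[of S "Min S - 1"] by auto
  then have "card {i \<in> S. i + 1 \<in> - S} \<ge> 1" "card {i \<in> S. i - 1 \<in> - S} \<ge> 1"
    using assms(1) by (auto simp: Suc_le_eq card_gt_0_iff)
  then show ?thesis by (simp add: contacts_def)
qed

text \<open>A gap would add a second right end to the one at the maximum, and the minimum is always a left end.\<close>

lemma interval_if_contacts_Compl_le_2:
  assumes "finite S" "S \<noteq> {}" "contacts S (- S) \<le> 2"
  shows "S = {Min S..Max S}"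
proof (rule ccontr)
  assume "S \<noteq> {Min S..Max S}"
  moreover have "S \<subseteq> {Min S..Max S}"
    using assms by auto
  ultimately obtain i where i: "Min S \<le> i" "i \<le> Max S" "i \<notin> S"
    by (metis atLeastAtMost_iff subsetI subset_antisym)
  then have i': "Min S < i" "i < Max S"
    using Min_in[OF assms(1,2)] Max_in[OF assms(1,2)] by (metis order_le_imp_less_or_eq)+
  define j where "j = Max {s \<in> S. s < i}"
  have fin: "finite {s \<in> S. s < i}" and ne: "{s \<in> S. s < i} \<noteq> {}"
    using assms i' Min_in by auto
  have j: "j \<in> S" "j < i"
    using Max_in[OF fin ne] unfolding j_def by auto
  have "j + 1 \<notin> S"
    using Max_ge[OF fin, of "j + 1"] i j j_def by (cases "j + 1 = i") auto
  moreover have "Max S + 1 \<notin> S"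
    using Max_ge[of S "Max S + 1"] assms by auto
  ultimately have "{j, Max S} \<subseteq> {i \<in> S. i + 1 \<in> - S}"
    using assms j by auto
  moreover have "card {j, Max S} = 2"
    using j i' by auto
  ultimately have "card {i \<in> S. i + 1 \<in> - S} \<ge> 2"
    using card_mono[of "{i \<in> S. i + 1 \<in> - S}" "{j, Max S}"] assms(1) by simp
  moreover have "Min S \<in> {i \<in> S. i - 1 \<in> - S}"
    using assms Min_le[of S "Min S - 1"] by auto
  then have "card {i \<in> S. i - 1 \<in> - S} \<noteq> 0"
    using assms(1) by (subst card_0_eq) auto
  ultimately show False
    using assms(3) by (simp add: contacts_def)
qed

lemma contacts_Compl_eq:
  assumes "finite S" "S \<inter> T = {}"
  shows "contacts S (- S) = contacts S T + contacts S (- (S \<union> T))"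
proof -
  have "- S = T \<union> - (S \<union> T)" using assms by auto
  then show ?thesis
    using contacts_Un_right[OF assms(1), of T "- (S \<union> T)"] by simp
qed

text \<open>Every end of \<open>S\<close> or of \<open>T\<close> either faces the other set or is an end of the union; the contacts between
  the two sets are seen from both sides.\<close>

lemma contacts_Compl_sum:
  assumes "finite S" "finite T" "S \<inter> T = {}"
  shows "contacts S (- S) + contacts T (- T)
    = 2 * contacts S T + contacts (S \<union> T) (- (S \<union> T))"
  using contacts_Compl_eq[of S T] contacts_Compl_eq[of T S] contacts_Un_left[OF assms]
    contacts_commute[of S T] assms by (simp add: Un_commute Int_commute)

text \<open>Without contacts the two sets pay for their ends separately. Otherwise the energy is
  \<open>2 - 2 * \<beta>\<close> for each contact plus the number of ends of the union, which is at least \<open>2\<close>.\<close>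

lemma line_energy_ge:
  assumes "finite S" "finite T" "S \<inter> T = {}" "0 \<le> \<beta>" "\<beta> \<le> 1"
  shows "line_energy \<beta> S T \<ge> line_bound \<beta> S T"
proof (cases "S = {} \<or> T = {}")
  case True
  then show ?thesis
    using contacts_Compl_ge_2[OF assms(1)] contacts_Compl_ge_2[OF assms(2)]
    by (cases "S = {}"; cases "T = {}") (simp_all add: line_energy_def line_bound_def)
next
  case False
  then have bound: "line_bound \<beta> S T = 4 - 2 * \<beta>"
    by (simp add: line_bound_def)
  show ?thesis
  proof (cases "contacts S T = 0")
    case True
    then show ?thesis
      using contacts_Compl_ge_2[OF assms(1)] contacts_Compl_ge_2[OF assms(2)] False bound assms(4)
      by (simp add: line_energy_def)
  next
    case k: False
    have "contacts (S \<union> T) (- (S \<union> T)) \<ge> 2"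
      using contacts_Compl_ge_2[of "S \<union> T"] False assms by auto
    moreover have "line_energy \<beta> S T
      = (2 - 2 * \<beta>) * contacts S T + contacts (S \<union> T) (- (S \<union> T))"
      using contacts_Compl_sum[OF assms(1-3)]
      by (simp add: line_energy_def algebra_simps flip: of_nat_add)
    moreover have "(2 - 2 * \<beta>) * 1 \<le> (2 - 2 * \<beta>) * real (contacts S T)"
      using k assms by (intro mult_left_mono) auto
    ultimately show ?thesis
      using bound by simp
  qed
qed

lemma interval_eq_card:
  assumes "(S :: int set) = {a..b}" "S \<noteq> {}"
  shows "S = {b + 1 - int (card S)..b}" "S = {a..a - 1 + int (card S)}"
  using assms by auto

text \<open>Without contact, the energy is at least \<open>4\<close>; the same holds with two contacts, since \<open>2 - 2 * \<beta> \<ge> 1\<close>.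
  Below this threshold there is thus exactly one contact and the union has two ends. Then \<open>S\<close> and \<open>T\<close>
  together have four ends, two for each, so both are intervals.\<close>

lemma line_energy_rigid:
  assumes "finite S" "finite T" "S \<inter> T = {}" "\<beta> \<le> 1 / 2"
    and "S \<noteq> {}" "T \<noteq> {}"
    and less: "line_energy \<beta> S T < line_bound \<beta> S T + 2 * \<beta>"
  obtains m where "S = {m + 1 - int (card S)..m}" "T = {m + 1..m + int (card T)}"
  | m where "T = {m + 1 - int (card T)..m}" "S = {m + 1..m + int (card S)}"
proof -
  let ?k = "contacts S T" and ?u = "contacts (S \<union> T) (- (S \<union> T))"
  have less: "line_energy \<beta> S T < 4"
    using less assms by (simp add: line_bound_def)
  have S2: "contacts S (- S) \<ge> 2" and T2: "contacts T (- T) \<ge> 2" and U2: "?u \<ge> 2"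
    using assms contacts_Compl_ge_2[of S] contacts_Compl_ge_2[of T]
      contacts_Compl_ge_2[of "S \<union> T"] by auto
  have sum: "contacts S (- S) + contacts T (- T) = 2 * ?k + ?u"
    by (rule contacts_Compl_sum[OF assms(1-3)])
  then have "line_energy \<beta> S T = (2 - 2 * \<beta>) * ?k + ?u"
    by (simp add: line_energy_def algebra_simps flip: of_nat_add)
  moreover have "1 * real ?k \<le> (2 - 2 * \<beta>) * ?k"
    using assms(4) by (intro mult_right_mono) auto
  ultimately have "real ?k + ?u < 4"
    using less by simp
  then have "?k + ?u < 4" by linarith
  moreover have "?k \<noteq> 0"
    using S2 T2 less by (intro notI) (simp add: line_energy_def)
  ultimately have "?k = 1" "?u = 2"
    using U2 by auto
  then have "contacts S (- S) \<le> 2" "contacts T (- T) \<le> 2"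
    using sum S2 T2 by auto
  then obtain a b c d where S: "S = {a..b}" and T: "T = {c..d}"
    using interval_if_contacts_Compl_le_2 assms by metis
  have "(\<exists>i\<in>S. i + 1 \<in> T) \<or> (\<exists>i\<in>S. i - 1 \<in> T)"
  proof (rule ccontr)
    assume "\<not> ?thesis"
    then have "{i \<in> S. i + 1 \<in> T} = {}" "{i \<in> S. i - 1 \<in> T} = {}" by auto
    then show False using \<open>?k \<noteq> 0\<close> unfolding contacts_def by (simp only: card.empty)
  qed
  then have "c = b + 1 \<or> a = d + 1"
  proof
    assume "\<exists>i\<in>S. i + 1 \<in> T"
    then obtain i where "i \<in> S" "i + 1 \<in> T" by auto
    moreover from this have "i + 1 \<notin> S" "i \<notin> T" using assms(3) by auto
    ultimately show ?thesis using S T by auto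
  next
    assume "\<exists>i\<in>S. i - 1 \<in> T"
    then obtain i where "i \<in> S" "i - 1 \<in> T" by auto
    moreover from this have "i - 1 \<notin> S" "i \<notin> T" using assms(3) by auto
    ultimately show ?thesis using S T by auto
  qed
  then show ?thesis
  proof
    assume "c = b + 1"
    then show ?thesis
      using that(1)[of b] interval_eq_card[OF S] interval_eq_card[OF T] assms by simp
  next
    assume "a = d + 1"
    then show ?thesis
      using that(2)[of d] interval_eq_card[OF S] interval_eq_card[OF T] assms by simp
  qed
qed

lemma line_energy_rigid_single:
  assumes "finite S" "S \<noteq> {}" "\<beta> \<le> 1 / 2"
    and "line_energy \<beta> S {} < line_bound \<beta> S {} + 2 * \<beta>"
  obtains m where "S = {m + 1..m + int (card S)}"
proof -
  have "contacts S (- S) \<le> 2"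
    using assms by (simp add: line_energy_def line_bound_def)
  then have "S = {Min S..Max S}"
    using interval_if_contacts_Compl_le_2 assms by blast
  from interval_eq_card(2)[OF this] show ?thesis
    using that[of "Min S - 1"] assms by simp
qed

section \<open>Slicing a pair of sets by lattice lines\<close>

definition hslice :: "int \<Rightarrow> lattice set \<Rightarrow> int set" where
  "hslice j A = {i. (i, j) \<in> A}"

definition vslice :: "int \<Rightarrow> lattice set \<Rightarrow> int set" where
  "vslice i A = {j. (i, j) \<in> A}"

lemma hslice_Compl [simp]: "hslice j (- A) = - hslice j A" and vslice_Compl [simp]: "vslice i (- A) = - vslice i A"
  by (auto simp: hslice_def vslice_def)

lemma hslice_eq_empty_iff: "hslice j A = {} \<longleftrightarrow> j \<notin> snd ` A"
  and vslice_eq_empty_iff: "vslice i A = {} \<longleftrightarrow> i \<notin> fst ` A"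
  by (force simp: hslice_def vslice_def)+

lemma hslice_subset: "hslice j A \<subseteq> fst ` A" and vslice_subset: "vslice i A \<subseteq> snd ` A"
  by (force simp: hslice_def vslice_def)+

lemma finite_hslice: "finite A \<Longrightarrow> finite (hslice j A)" and finite_vslice: "finite A \<Longrightarrow> finite (vslice i A)"
  by (auto intro: finite_subset[OF hslice_subset] finite_subset[OF vslice_subset])

lemma hslice_disjoint: "A \<inter> B = {} \<Longrightarrow> hslice j A \<inter> hslice j B = {}"
  and vslice_disjoint: "A \<inter> B = {} \<Longrightarrow> vslice i A \<inter> vslice i B = {}"
  by (auto simp: hslice_def vslice_def)

lemma card_eq_sum_hslice:
  assumes "finite A" "finite J" "snd ` A \<subseteq> J"
  shows "card A = (\<Sum>j\<in>J. card (hslice j A))"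
proof -
  have "card A = card ((\<lambda>(j, i). (i, j)) ` Sigma J (\<lambda>j. hslice j A))"
    using assms by (intro arg_cong[of _ _ card]) (force simp: hslice_def)
  also have "\<dots> = card (Sigma J (\<lambda>j. hslice j A))"
    by (intro card_image) (auto simp: inj_on_def)
  finally show ?thesis
    using assms finite_hslice by (simp add: card_SigmaI)
qed

lemma card_eq_sum_vslice:
  assumes "finite A" "finite I" "fst ` A \<subseteq> I"
  shows "card A = (\<Sum>i\<in>I. card (vslice i A))"
proof -
  have "card A = card (Sigma I (\<lambda>i. vslice i A))"
    using assms by (intro arg_cong[of _ _ card]) (force simp: vslice_def)
  then show ?thesis
    using assms finite_vslice by (simp add: card_SigmaI)
qed

lemma int_sum_squares_eq_1_iff:
  fixes a b :: int
  shows "a\<^sup>2 + b\<^sup>2 = 1 \<longleftrightarrow> (a, b) \<in> {(1, 0), (- 1, 0), (0, 1), (0, - 1)}"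
proof
  assume h: "a\<^sup>2 + b\<^sup>2 = 1"
  have "a\<^sup>2 \<le> 1\<^sup>2" "b\<^sup>2 \<le> 1\<^sup>2"
    using h zero_le_power2[of a] zero_le_power2[of b] by (unfold one_power2, linarith+)
  then have "\<bar>a\<bar> \<le> 1" "\<bar>b\<bar> \<le> 1"
    by (simp_all only: abs_le_square_iff[symmetric] abs_one)
  then have "a \<in> {-1, 0, 1}" "b \<in> {-1, 0, 1}" by auto
  then show "(a, b) \<in> {(1, 0), (- 1, 0), (0, 1), (0, - 1)}"
    using h by auto
qed auto

text \<open>A bond is a unit step in a coordinate direction, so that every bond lies on exactly one lattice line.\<close>

lemma norm_lattice_embed_eq_1_iff:
  "norm (lattice_embed c - lattice_embed d) = 1 \<longleftrightarrow>
     d - c \<in> {(1, 0), (- 1, 0), (0, 1), (0, - 1)}"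
proof -
  obtain a b where ab: "d - c = (a, b)" by force
  have "norm (lattice_embed c - lattice_embed d) = sqrt (real_of_int (a\<^sup>2 + b\<^sup>2))"
    using ab by (cases c; cases d)
      (auto simp: lattice_embed_def norm_prod_def power2_commute)
  then have "norm (lattice_embed c - lattice_embed d) = 1 \<longleftrightarrow> a\<^sup>2 + b\<^sup>2 = 1"
    by (simp only: real_sqrt_eq_1_iff of_int_eq_1_iff)
  then show ?thesis
    by (simp only: ab int_sum_squares_eq_1_iff)
qed

lemma Q_eq_sum_steps:
  assumes "finite C"
  shows "Q C D = (\<Sum>v\<in>{(1, 0), (- 1, 0), (0, 1), (0, - 1)}. card {z \<in> C. z + v \<in> D})"
proof -
  let ?V = "{(1, 0), (- 1, 0), (0, 1), (0, - 1)} :: lattice set"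
  have "{(c, d). c \<in> C \<and> d \<in> D \<and> norm (lattice_embed c - lattice_embed d) = 1}
    = (\<lambda>(v, z). (z, z + v)) ` Sigma ?V (\<lambda>v. {z \<in> C. z + v \<in> D})" (is "?E = ?F")
  proof (rule set_eqI)
    fix e :: "lattice \<times> lattice"
    obtain c d where e: "e = (c, d)" by (rule prod.exhaust)
    have "e \<in> ?E \<longleftrightarrow> c \<in> C \<and> d \<in> D \<and> d - c \<in> ?V"
      unfolding e norm_lattice_embed_eq_1_iff by simp
    also have "\<dots> \<longleftrightarrow> e \<in> ?F"
    proof
      assume "c \<in> C \<and> d \<in> D \<and> d - c \<in> ?V"
      then show "e \<in> ?F"
        unfolding e by (intro image_eqI[of _ _ "(d - c, c)"]) (simp_all del: insert_iff)
    next
      assume "e \<in> ?F"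
      then show "c \<in> C \<and> d \<in> D \<and> d - c \<in> ?V"
        unfolding e by (auto simp del: insert_iff)
    qed
    finally show "e \<in> ?E \<longleftrightarrow> e \<in> ?F" .
  qed
  then have "Q C D = card (Sigma ?V (\<lambda>v. {z \<in> C. z + v \<in> D}))"
    unfolding Q_def by (simp only:) (intro card_image, auto simp: inj_on_def)
  then show ?thesis
    using assms by (subst (asm) card_SigmaI) simp_all
qed

lemma Q_eq_sum_contacts:
  assumes "finite C" "finite I" "finite J" "fst ` C \<subseteq> I" "snd ` C \<subseteq> J"
  shows "Q C D = (\<Sum>j\<in>J. contacts (hslice j C) (hslice j D)) + (\<Sum>i\<in>I. contacts (vslice i C) (vslice i D))"
proof -
  have fin: "finite {z \<in> C. R z}" for R
    using assms by simp
  have J: "snd ` {z \<in> C. R z} \<subseteq> J" and I: "fst ` {z \<in> C. R z} \<subseteq> I" for R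
    using assms by auto
  have "hslice j {z \<in> C. z + (1, 0) \<in> D} = {i \<in> hslice j C. i + 1 \<in> hslice j D}"
    "hslice j {z \<in> C. z + (- 1, 0) \<in> D} = {i \<in> hslice j C. i - 1 \<in> hslice j D}"
    "vslice i {z \<in> C. z + (0, 1) \<in> D} = {j \<in> vslice i C. j + 1 \<in> vslice i D}"
    "vslice i {z \<in> C. z + (0, - 1) \<in> D} = {j \<in> vslice i C. j - 1 \<in> vslice i D}" for i j
    by (auto simp: hslice_def vslice_def)
  then have "card {z \<in> C. z + (1, 0) \<in> D} = (\<Sum>j\<in>J. card {i \<in> hslice j C. i + 1 \<in> hslice j D})"
    "card {z \<in> C. z + (- 1, 0) \<in> D} = (\<Sum>j\<in>J. card {i \<in> hslice j C. i - 1 \<in> hslice j D})"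
    "card {z \<in> C. z + (0, 1) \<in> D} = (\<Sum>i\<in>I. card {j \<in> vslice i C. j + 1 \<in> vslice i D})"
    "card {z \<in> C. z + (0, - 1) \<in> D} = (\<Sum>i\<in>I. card {j \<in> vslice i C. j - 1 \<in> vslice i D})"
    by (simp_all only: card_eq_sum_hslice[OF fin assms(3) J, of "\<lambda>z. z + (1, 0) \<in> D"]
        card_eq_sum_hslice[OF fin assms(3) J, of "\<lambda>z. z + (- 1, 0) \<in> D"]
        card_eq_sum_vslice[OF fin assms(2) I, of "\<lambda>z. z + (0, 1) \<in> D"]
        card_eq_sum_vslice[OF fin assms(2) I, of "\<lambda>z. z + (0, - 1) \<in> D"])
  then show ?thesis
    by (simp add: Q_eq_sum_steps[OF assms(1)] contacts_def sum.distrib)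
qed

lemma P_eq_sum_line_energy:
  assumes "finite A" "finite B" "finite I" "finite J"
    and "fst ` (A \<union> B) \<subseteq> I" "snd ` (A \<union> B) \<subseteq> J"
  shows "P \<beta> A B = (\<Sum>j\<in>J. line_energy \<beta> (hslice j A) (hslice j B))
    + (\<Sum>i\<in>I. line_energy \<beta> (vslice i A) (vslice i B))"
proof -
  have "fst ` A \<subseteq> I" "snd ` A \<subseteq> J" "fst ` B \<subseteq> I" "snd ` B \<subseteq> J"
    using assms by auto
  then have "Q A (- A) = (\<Sum>j\<in>J. contacts (hslice j A) (- hslice j A)) + (\<Sum>i\<in>I. contacts (vslice i A) (- vslice i A))"
    "Q B (- B) = (\<Sum>j\<in>J. contacts (hslice j B) (- hslice j B)) + (\<Sum>i\<in>I. contacts (vslice i B) (- vslice i B))"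
    "Q A B = (\<Sum>j\<in>J. contacts (hslice j A) (hslice j B)) + (\<Sum>i\<in>I. contacts (vslice i A) (vslice i B))"
    using assms by (simp_all add: Q_eq_sum_contacts[of _ I J])
  then show ?thesis
    by (simp add: P_def line_energy_def sum.distrib sum_subtractf distrib_left
        flip: sum_distrib_left)
qed

definition projection_bound :: "real \<Rightarrow> lattice set \<Rightarrow> lattice set \<Rightarrow> real" where
  "projection_bound \<beta> A B =
     2 * real (card (fst ` A) + card (fst ` B) + card (snd ` A) + card (snd ` B))
     - 2 * \<beta> * real (card (fst ` A \<inter> fst ` B) + card (snd ` A \<inter> snd ` B))"

text \<open>Row \<open>j\<close> meets a set exactly if \<open>j\<close> lies in the second projection of the set, and correspondingly for columns.\<close>

lemma sum_line_bound:
  assumes "finite I" "finite J" "fst ` (A \<union> B) \<subseteq> I" "snd ` (A \<union> B) \<subseteq> J"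
  shows "(\<Sum>j\<in>J. line_bound \<beta> (hslice j A) (hslice j B)) + (\<Sum>i\<in>I. line_bound \<beta> (vslice i A) (vslice i B))
    = projection_bound \<beta> A B"
proof -
  have "fst ` A \<subseteq> I" "snd ` A \<subseteq> J" "fst ` B \<subseteq> I" "snd ` B \<subseteq> J"
    "fst ` A \<inter> fst ` B \<subseteq> I" "snd ` A \<inter> snd ` B \<subseteq> J"
    using assms by auto
  then show ?thesis
    using assms
    by (simp add: line_bound_def hslice_eq_empty_iff vslice_eq_empty_iff projection_bound_def
        sum.distrib sum_subtractf Int_absorb1 algebra_simps flip: sum_distrib_left Int_iff)
qed

text \<open>The total excess over \<open>projection_bound\<close> is a sum of nonnegative contributions of the lines. Lines on which
  the rigidity statement for the line energy fails contribute at least \<open>2 * \<beta>\<close> each, so there are few of them.\<close>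

lemma bad_lines_le:
  fixes \<beta> :: real
  assumes "finite A" "finite B" "A \<inter> B = {}" "0 \<le> \<beta>" "\<beta> \<le> 1"
  defines "E \<equiv> P \<beta> A B - projection_bound \<beta> A B"
  shows "2 * \<beta> * card {j \<in> snd ` (A \<union> B).
      line_bound \<beta> (hslice j A) (hslice j B) + 2 * \<beta> \<le> line_energy \<beta> (hslice j A) (hslice j B)} \<le> E"
    (is "2 * \<beta> * card ?J \<le> E")
    and "2 * \<beta> * card {i \<in> fst ` (A \<union> B).
      line_bound \<beta> (vslice i A) (vslice i B) + 2 * \<beta> \<le> line_energy \<beta> (vslice i A) (vslice i B)} \<le> E"
    (is "2 * \<beta> * card ?I \<le> E")
proof -
  let ?r = "\<lambda>j. line_energy \<beta> (hslice j A) (hslice j B) - line_bound \<beta> (hslice j A) (hslice j B)"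
  let ?c = "\<lambda>i. line_energy \<beta> (vslice i A) (vslice i B) - line_bound \<beta> (vslice i A) (vslice i B)"
  have E: "E = (\<Sum>j\<in>snd ` (A \<union> B). ?r j) + (\<Sum>i\<in>fst ` (A \<union> B). ?c i)"
    unfolding E_def using assms
    by (simp add: P_eq_sum_line_energy[of A B "fst ` (A \<union> B)" "snd ` (A \<union> B)"]
        sum_line_bound[of "fst ` (A \<union> B)" "snd ` (A \<union> B)", symmetric] sum_subtractf)
  have r: "?r j \<ge> 0" for j
    using assms by (simp add: line_energy_ge finite_hslice hslice_disjoint)
  have c: "?c i \<ge> 0" for i
    using assms by (simp add: line_energy_ge finite_vslice vslice_disjoint)
  have "2 * \<beta> * card ?J = (\<Sum>j\<in>?J. 2 * \<beta>)" by simp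
  also have "\<dots> \<le> (\<Sum>j\<in>?J. ?r j)" by (rule sum_mono) auto
  also have "\<dots> \<le> (\<Sum>j\<in>snd ` (A \<union> B). ?r j)"
    using assms r by (intro sum_mono2) auto
  also have "\<dots> \<le> E" unfolding E using c by (simp add: sum_nonneg)
  finally show "2 * \<beta> * card ?J \<le> E" .
  have "2 * \<beta> * card ?I = (\<Sum>i\<in>?I. 2 * \<beta>)" by simp
  also have "\<dots> \<le> (\<Sum>i\<in>?I. ?c i)" by (rule sum_mono) auto
  also have "\<dots> \<le> (\<Sum>i\<in>fst ` (A \<union> B). ?c i)"
    using assms c by (intro sum_mono2) auto
  also have "\<dots> \<le> E" unfolding E using r by (simp add: sum_nonneg)
  finally show "2 * \<beta> * card ?I \<le> E" .
qed

lemma projection_bound_le_P: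
  assumes "finite A" "finite B" "A \<inter> B = {}" "0 \<le> \<beta>" "\<beta> \<le> 1"
  shows "projection_bound \<beta> A B \<le> P \<beta> A B"
proof -
  have "0 \<le> P \<beta> A B - projection_bound \<beta> A B"
    by (rule order_trans[OF _ bad_lines_le(1)[OF assms]]) (use assms(4) in simp)
  then show ?thesis by simp
qed

lemma square_plus_le_product:
  assumes "(z::nat) \<le> p + q"
  shows "N\<^sup>2 + N * z \<le> (N + p) * (N + q)"
proof -
  have "N * z \<le> N * (p + q)" using assms by simp
  then show ?thesis by (simp add: power2_eq_square algebra_simps)
qed

text \<open>Each point in the product of the two intersections of projections is missing from at least one of the
  disjoint sets \<open>A\<close> and \<open>B\<close>, although it lies in the product of the projections of either.\<close>

lemma projections_product_ge:
  assumes "finite A" "finite B" "A \<inter> B = {}" "card A = N" "card B = N"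
  shows "N\<^sup>2 + N * (card (fst ` A \<inter> fst ` B) * card (snd ` A \<inter> snd ` B))
    \<le> (card (fst ` A) * card (snd ` A)) * (card (fst ` B) * card (snd ` B))"
proof -
  define Z where "Z = (fst ` A \<inter> fst ` B) \<times> (snd ` A \<inter> snd ` B)"
  have fin: "finite Z" using assms by (simp add: Z_def)
  have *: "card C + card (Z - C) \<le> card (fst ` C) * card (snd ` C)"
    if "finite C" "Z \<subseteq> fst ` C \<times> snd ` C" for C
  proof -
    have "card C + card (Z - C) = card (C \<union> (Z - C))"
      using that fin by (intro card_Un_disjoint[symmetric]) auto
    also have "\<dots> \<le> card (fst ` C \<times> snd ` C)"
    proof (rule card_mono)
      show "C \<union> (Z - C) \<subseteq> fst ` C \<times> snd ` C"
        using that(2) by (auto simp: subset_iff intro: rev_image_eqI)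
    qed (use that in simp)
    finally show ?thesis by (simp add: card_cartesian_product)
  qed
  have "card Z \<le> card (Z - A) + card (Z - B)"
    using card_Un_le[of "Z - A" "Z - B"] assms(3)
    by (simp flip: Diff_Int)
  then have "N\<^sup>2 + N * card Z \<le> (N + card (Z - A)) * (N + card (Z - B))"
    by (rule square_plus_le_product)
  also have "\<dots> \<le> (card (fst ` A) * card (snd ` A)) * (card (fst ` B) * card (snd ` B))"
    using *[of A] *[of B] assms by (intro mult_le_mono) (auto simp: Z_def)
  finally show ?thesis by (simp add: Z_def card_cartesian_product)
qed

section \<open>An upper bound for the minimum\<close>

text \<open>The first \<open>N\<close> points of the half strip of height \<open>H\<close>, filled column by column: \<open>i * H + j\<close> is the position of
  \<open>(i, j)\<close> in this order.\<close>

definition column_stack :: "nat \<Rightarrow> int \<Rightarrow> lattice set" where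
  "column_stack N H = {(i, j). 0 \<le> i \<and> 0 \<le> j \<and> j < H \<and> i * H + j < int N}"

text \<open>Column \<open>0\<close> is mapped to column \<open>- 1\<close>, so that the two stacks touch without overlapping.\<close>

definition reflected_stack :: "nat \<Rightarrow> int \<Rightarrow> lattice set" where
  "reflected_stack N H = {(i, j). (- 1 - i, j) \<in> column_stack N H}"

lemma bij_betw_column_stack:
  assumes "H > 0"
  shows "bij_betw (\<lambda>(i, j). i * H + j) (column_stack N H) {0..<int N}"
proof (rule bij_betw_byWitness[where f' = "\<lambda>n. (n div H, n mod H)"])
  show "(\<lambda>(i, j). i * H + j) ` column_stack N H \<subseteq> {0..<int N}"
    using assms by (auto simp: column_stack_def)
  show "(\<lambda>n. (n div H, n mod H)) ` {0..<int N} \<subseteq> column_stack N H"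
    using assms by (auto simp: column_stack_def pos_imp_zdiv_nonneg_iff)
qed (use assms in \<open>auto simp: column_stack_def\<close>)

lemma bij_betw_reflected_stack:
  "bij_betw (\<lambda>(i, j). (- 1 - i, j)) (reflected_stack N H) (column_stack N H)"
  by (rule bij_betw_byWitness[where f' = "\<lambda>(i, j). (- 1 - i, j)"]) (auto simp: reflected_stack_def)

lemma admissible_stacks:
  assumes "H > 0"
  shows "admissible N (reflected_stack N H) (column_stack N H)"
proof -
  have "finite (column_stack N H)" "card (column_stack N H) = N"
    using bij_betw_finite[OF bij_betw_column_stack[OF assms]]
      bij_betw_same_card[OF bij_betw_column_stack[OF assms]] by auto
  moreover have "finite (reflected_stack N H)" "card (reflected_stack N H) = N"
    using bij_betw_finite[OF bij_betw_reflected_stack] bij_betw_same_card[OF bij_betw_reflected_stack]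
      calculation by auto
  moreover have "reflected_stack N H \<inter> column_stack N H = {}"
    by (auto simp: reflected_stack_def column_stack_def)
  ultimately show ?thesis by (simp add: admissible_def)
qed

lemma contacts_interval_Compl_le: "contacts {a..b} (- {a..b}) \<le> 2"
proof -
  have "{i \<in> {a..b}. i + 1 \<in> - {a..b}} \<subseteq> {b}" "{i \<in> {a..b}. i - 1 \<in> - {a..b}} \<subseteq> {a}"
    by auto
  then have "card {i \<in> {a..b}. i + 1 \<in> - {a..b}} \<le> 1" "card {i \<in> {a..b}. i - 1 \<in> - {a..b}} \<le> 1"
    using card_mono[of "{b}" "{i \<in> {a..b}. i + 1 \<in> - {a..b}}"]
      card_mono[of "{a}" "{i \<in> {a..b}. i - 1 \<in> - {a..b}}"] by simp_all
  then show ?thesis by (simp add: contacts_def)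
qed

lemma line_energy_adjacent_le:
  assumes "0 \<le> \<beta>" "\<beta> \<le> 1"
  shows "line_energy \<beta> {- 1 - c..- 1} {0..c} \<le> 4 - 2 * \<beta>"
proof (cases "c < 0")
  case True
  then show ?thesis using assms by (simp add: line_energy_def)
next
  case False
  then have "- 1 \<in> {i \<in> {- 1 - c..- 1}. i + 1 \<in> {0..c}}" by auto
  moreover have "finite {i \<in> {- 1 - c..- 1}. i + 1 \<in> {0..c}}"
    by (rule finite_subset[of _ "{- 1 - c..- 1}"]) auto
  ultimately have "card {i \<in> {- 1 - c..- 1}. i + 1 \<in> {0..c}} \<noteq> 0"
    by (metis (no_types) card_0_eq empty_iff)
  then have "contacts {- 1 - c..- 1} {0..c} \<ge> 1"
    unfolding contacts_def by linarith
  then have "2 * \<beta> * 1 \<le> 2 * \<beta> * real (contacts {- 1 - c..- 1} {0..c})"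
    using assms by (intro mult_left_mono) auto
  then show ?thesis
    using contacts_interval_Compl_le[of "- 1 - c" "- 1"] contacts_interval_Compl_le[of 0 c]
    by (simp add: line_energy_def)
qed

lemma le_zdiv_iff:
  fixes i a H :: int
  assumes "H > 0"
  shows "i \<le> a div H \<longleftrightarrow> i * H \<le> a"
proof
  assume "i \<le> a div H"
  then have "i * H \<le> (a div H) * H" using assms by simp
  also have "\<dots> \<le> a" using assms div_mult_mod_eq[of a H] pos_mod_sign[OF assms, of a] by linarith
  finally show "i * H \<le> a" .
next
  assume "i * H \<le> a"
  from zdiv_mono1[OF this assms] show "i \<le> a div H" using assms by simp
qed

text \<open>Each of the at most \<open>2 * W\<close> columns carries a single interval, and each of the \<open>H\<close> rows two intervals of
  equal length that touch at the axis.\<close>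

lemma P_stacks_le:
  assumes "H > 0" "W \<ge> 0" "int N \<le> W * H" "0 \<le> \<beta>" "\<beta> \<le> 1"
  shows "P \<beta> (reflected_stack N H) (column_stack N H) \<le> 4 * real_of_int W + (4 - 2 * \<beta>) * real_of_int H"
proof -
  let ?A = "reflected_stack N H" and ?B = "column_stack N H"
  have W: "i < W" if "(i, j) \<in> ?B" for i j
  proof -
    have "i * H + j < int N" "0 \<le> j" using that by (auto simp: column_stack_def)
    then have "i * H < W * H" using assms(3) by linarith
    then show ?thesis using assms(1) by simp
  qed
  have fin: "finite ?A" "finite ?B"
    using admissible_stacks[OF assms(1)] by (auto simp: admissible_def)
  have "P \<beta> ?A ?B = (\<Sum>j\<in>{0..<H}. line_energy \<beta> (hslice j ?A) (hslice j ?B))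
      + (\<Sum>i\<in>{- W..<W}. line_energy \<beta> (vslice i ?A) (vslice i ?B))"
  proof (rule P_eq_sum_line_energy[OF fin])
    have "i \<in> {- W..<W}" if "(i, j) \<in> ?A \<union> ?B" for i j
      using W[of i j] W[of "- 1 - i" j] that
      by (auto simp: reflected_stack_def column_stack_def)
    then show "fst ` (?A \<union> ?B) \<subseteq> {- W..<W}" by force
  qed (auto simp: reflected_stack_def column_stack_def)
  moreover have "line_energy \<beta> (hslice j ?A) (hslice j ?B) \<le> 4 - 2 * \<beta>" if "j \<in> {0..<H}" for j
  proof -
    have *: "i * H + j < int N \<longleftrightarrow> i \<le> (int N - 1 - j) div H" for i
      using le_zdiv_iff[OF assms(1), of i "int N - 1 - j"] by auto
    have "hslice j ?B = {0..(int N - 1 - j) div H}"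
      using that unfolding hslice_def column_stack_def mem_Collect_eq prod.case * by auto
    moreover have "hslice j ?A = {- 1 - (int N - 1 - j) div H..- 1}"
      using that unfolding hslice_def reflected_stack_def column_stack_def mem_Collect_eq prod.case *
      by auto
    ultimately show ?thesis using line_energy_adjacent_le assms by simp
  qed
  then have "(\<Sum>j\<in>{0..<H}. line_energy \<beta> (hslice j ?A) (hslice j ?B)) \<le> (\<Sum>j\<in>{0..<H}. 4 - 2 * \<beta>)"
    by (rule sum_mono)
  moreover have "line_energy \<beta> (vslice i ?A) (vslice i ?B) \<le> 2" for i
  proof -
    have B: "vslice i ?B = (if i \<ge> 0 then {0..min (H - 1) (int N - 1 - i * H)} else {})" for i
      by (auto simp: vslice_def column_stack_def)
    moreover have "vslice i ?A = vslice (- 1 - i) ?B" for i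
      by (auto simp: vslice_def reflected_stack_def)
    ultimately show ?thesis
      using contacts_interval_Compl_le[of 0] by (simp add: line_energy_def)
  qed
  then have "(\<Sum>i\<in>{- W..<W}. line_energy \<beta> (vslice i ?A) (vslice i ?B)) \<le> (\<Sum>i\<in>{- W..<W}. 2)"
    by (intro sum_mono)
  ultimately show ?thesis using assms by (simp add: mult.commute)
qed

text \<open>The competitor has height about \<open>2 * sqrt N / c\<close> and width about \<open>c * sqrt N / 2\<close> on each side, where
  \<open>c\<^sup>2 = 4 - 2 * \<beta>\<close>. This balances the two terms in the energy of the stacks; rounding up costs at most
  \<open>4 + (4 - 2 * \<beta>)\<close>.\<close>

lemma P_solution_le:
  assumes "double_bubble_solution \<beta> N A B" "0 < \<beta>" "\<beta> < 1" "N \<ge> 1"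
  shows "P \<beta> A B \<le> 4 * sqrt (4 - 2 * \<beta>) * sqrt N + 8"
proof -
  let ?c = "sqrt (4 - 2 * \<beta>)"
  define H W where "H = \<lceil>2 / ?c * sqrt N\<rceil>" and "W = \<lceil>?c / 2 * sqrt N\<rceil>"
  have c: "?c > 0" "?c * ?c = 4 - 2 * \<beta>" using assms by auto
  have "2 / ?c * sqrt N > 0" "?c / 2 * sqrt N > 0" using c assms by auto
  then have pos: "H > 0" "W > 0" unfolding H_def W_def by linarith+
  have "real N = (?c / 2 * sqrt N) * (2 / ?c * sqrt N)"
    using c by simp
  also have "\<dots> \<le> of_int W * of_int H"
  proof (rule mult_mono)
    show "?c / 2 * sqrt N \<le> of_int W" "2 / ?c * sqrt N \<le> of_int H"
      unfolding W_def H_def by (rule le_of_int_ceiling)+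
  qed (use pos c in auto)
  finally have "int N \<le> W * H"
    by (metis of_int_le_iff of_int_mult of_int_of_nat_eq)
  then have "P \<beta> (reflected_stack N H) (column_stack N H) \<le> 4 * real_of_int W + (4 - 2 * \<beta>) * real_of_int H"
    using P_stacks_le pos assms by simp
  also have "\<dots> \<le> 4 * (?c / 2 * sqrt N + 1) + (4 - 2 * \<beta>) * (2 / ?c * sqrt N + 1)"
  proof -
    have W: "of_int W \<le> ?c / 2 * sqrt N + 1" and H: "of_int H \<le> 2 / ?c * sqrt N + 1"
      unfolding W_def H_def by (rule of_int_ceiling_le_add_one)+
    show ?thesis
      using assms by (intro add_mono mult_left_mono W H) auto
  qed
  also have "\<dots> = 2 * ?c * sqrt N + 4 + (2 * ((4 - 2 * \<beta>) / ?c) * sqrt N + (4 - 2 * \<beta>))"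
    by (simp add: algebra_simps)
  also have "(4 - 2 * \<beta>) / ?c = ?c"
    using assms by (intro real_div_sqrt) simp
  also have "2 * ?c * sqrt N + 4 + (2 * ?c * sqrt N + (4 - 2 * \<beta>)) \<le> 4 * ?c * sqrt N + 8"
    using assms by simp
  also have "P \<beta> A B \<le> P \<beta> (reflected_stack N H) (column_stack N H)"
    using assms(1) admissible_stacks[OF pos(1), of N]
    by (auto simp: double_bubble_solution_def is_arg_min_linorder)
  finally show ?thesis by simp
qed

section \<open>The optimal proportions\<close>

text \<open>The left-hand side is concave in each variable, so on the unit square it lies above the bilinear
  interpolation of its values at the corners. These are \<open>1\<close> at the origin, \<open>u = 1 - \<beta> / 2\<close> at the two corners
  where the bound is attained, and \<open>3 / 2 * u\<^sup>2\<close> at \<open>(1, 1)\<close>. The last one exceeds \<open>u\<close> by at least \<open>3 / 32\<close>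
  when \<open>u \<ge> 3 / 4\<close>, that is, when \<open>\<beta> \<le> 1 / 2\<close>.\<close>

lemma profile_polynomial_ge:
  fixes \<beta> X Y :: real
  assumes "0 < \<beta>" "\<beta> \<le> 1 / 2" "0 \<le> X" "X \<le> 1" "0 \<le> Y" "Y \<le> 1"
  shows "(1 + X * Y / 2) * (1 - \<beta> * X / 2) * (1 - \<beta> * Y / 2)
    \<ge> (1 - \<beta> / 2) + \<beta> / 2 * ((1 - X) * (1 - Y)) + 3 / 32 * (X * Y)"
proof -
  define u where "u = 1 - \<beta> / 2"
  have u: "3 / 4 \<le> u" using assms by (simp add: u_def)
  have "(u - 3 / 4) * (3 / 2 * u + 1 / 8) \<ge> 0" using u by simp
  then have u2: "3 / 2 * u\<^sup>2 - u - 3 / 32 \<ge> 0"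
    by (simp add: algebra_simps power2_eq_square)
  have bY: "1 - \<beta> * Y / 2 \<ge> 0" using assms mult_mono[of \<beta> 1 Y 1] by simp
  have "(1 + X * Y / 2) * (1 - \<beta> * X / 2) * (1 - \<beta> * Y / 2)
      - (u + \<beta> / 2 * ((1 - X) * (1 - Y)) + 3 / 32 * (X * Y))
    = X * Y * (3 / 2 * u\<^sup>2 - u - 3 / 32) + \<beta> / 4 * u * (X * (Y * (1 - Y)))
      + \<beta> / 4 * (1 - \<beta> * Y / 2) * (Y * (X * (1 - X)))"
    unfolding u_def by (simp add: field_simps power2_eq_square)
  \<comment> \<open>The first summand is the surplus at the corner \<open>(1, 1)\<close>; the terms with \<open>Y * (1 - Y)\<close> and \<open>X * (1 - X)\<close> are the
    interpolation errors of a concave quadratic in \<open>Y\<close> and in \<open>X\<close>.\<close>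
  also have "\<dots> \<ge> 0"
    using assms u u2 bY by (intro add_nonneg_nonneg mult_nonneg_nonneg) auto
  finally show ?thesis by (simp add: u_def)
qed

text \<open>With \<open>k = (w1 + w2) * (h1 + h2) / 4\<close>, the arithmetic-geometric mean inequality turns the hypothesis on the areas
  into \<open>1 + k * X * Y \<le> k\<^sup>2\<close>, which forces \<open>k \<ge> 1 + X * Y / 2\<close>. The product to be estimated is
  \<open>4 * k * (1 - \<beta> * X / 2) * (1 - \<beta> * Y / 2)\<close>, so the polynomial inequality applies.\<close>

lemma profile_inequality:
  fixes \<beta> w1 w2 h1 h2 x y :: real
  assumes \<beta>: "0 < \<beta>" "\<beta> \<le> 1 / 2"
    and x: "0 \<le> x" "x \<le> w1" "x \<le> w2" and y: "0 \<le> y" "y \<le> h1" "y \<le> h2"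
    and pos: "0 < w1" "0 < w2" "0 < h1" "0 < h2"
    and area: "1 + x * y \<le> (w1 * h1) * (w2 * h2)"
  defines "X \<equiv> 2 * x / (w1 + w2)" and "Y \<equiv> 2 * y / (h1 + h2)"
  shows "(w1 + w2 - \<beta> * x) * (h1 + h2 - \<beta> * y)
    \<ge> 4 - 2 * \<beta> + 2 * \<beta> * ((1 - X) * (1 - Y)) + 3 / 8 * (X * Y)"
proof -
  define W H k where "W = w1 + w2" and "H = h1 + h2" and "k = W * H / 4"
  have WH: "W > 0" "H > 0" and k: "k > 0" using pos by (auto simp: W_def H_def k_def)
  have xX: "x = W * X / 2" and yY: "y = H * Y / 2"
    using WH by (auto simp: X_def Y_def W_def H_def)
  have X: "0 \<le> X" "X \<le> 1" and Y: "0 \<le> Y" "Y \<le> 1"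
    using x y WH by (auto simp: X_def Y_def W_def H_def divide_simps)
  have "1 + k * (X * Y) = 1 + x * y" by (simp add: xX yY k_def)
  also have "\<dots> \<le> (w1 * w2) * (h1 * h2)" using area by (simp add: mult_ac)
  also have "\<dots> \<le> (W\<^sup>2 / 4) * (H\<^sup>2 / 4)"
  proof (rule mult_mono)
    show "w1 * w2 \<le> W\<^sup>2 / 4" "h1 * h2 \<le> H\<^sup>2 / 4"
      using zero_le_power2[of "w1 - w2"] zero_le_power2[of "h1 - h2"]
      by (simp_all add: W_def H_def power2_eq_square algebra_simps)
  qed (use pos in auto)
  also have "\<dots> = k\<^sup>2" by (simp add: k_def power2_eq_square)
  finally have k1: "1 + k * (X * Y) \<le> k\<^sup>2" .
  have k2: "1 + X * Y / 2 \<le> k"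
  proof (rule ccontr)
    let ?u = "X * Y"
    assume "\<not> ?thesis"
    then have lt: "k < 1 + ?u / 2" by simp
    have "1 \<le> k * (k - ?u)" using k1 by (simp add: power2_eq_square algebra_simps)
    then have ku: "0 < k - ?u"
      using k by (smt (verit) mult_nonneg_nonpos)
    have "k * (k - ?u) < (1 + ?u / 2) * (1 - ?u / 2)"
      using lt ku k by (intro mult_strict_mono) auto
    also have "\<dots> = 1 - ?u\<^sup>2 / 4" by (simp add: power2_eq_square field_simps)
    finally show False
      using \<open>1 \<le> k * (k - ?u)\<close> zero_le_power2[of ?u] by simp
  qed
  have b: "1 - \<beta> * X / 2 \<ge> 0" "1 - \<beta> * Y / 2 \<ge> 0"
    using \<beta> X Y mult_mono[of \<beta> 1 X 1] mult_mono[of \<beta> 1 Y 1] by auto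
  have "(1 - \<beta> / 2) + \<beta> / 2 * ((1 - X) * (1 - Y)) + 3 / 32 * (X * Y)
      \<le> (1 + X * Y / 2) * (1 - \<beta> * X / 2) * (1 - \<beta> * Y / 2)"
    by (rule profile_polynomial_ge[OF \<beta> X Y])
  also have "\<dots> \<le> k * (1 - \<beta> * X / 2) * (1 - \<beta> * Y / 2)"
    using k2 b by (intro mult_right_mono) auto
  also have "\<dots> = (W - \<beta> * x) * (H - \<beta> * y) / 4"
    by (simp add: xX yY k_def field_simps)
  finally show ?thesis by (simp add: W_def H_def)
qed

lemma tendsto_of_power2_tendsto:
  fixes f :: "nat \<Rightarrow> real"
  assumes "(\<lambda>n. (f n)\<^sup>2) \<longlonglongrightarrow> a\<^sup>2" "eventually (\<lambda>n. 0 \<le> f n) sequentially" "0 \<le> a"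
  shows "f \<longlonglongrightarrow> a"
proof -
  have "(\<lambda>n. sqrt ((f n)\<^sup>2)) \<longlonglongrightarrow> sqrt (a\<^sup>2)"
    by (intro tendsto_intros assms)
  moreover have "eventually (\<lambda>n. sqrt ((f n)\<^sup>2) = f n) sequentially"
    using assms(2) by eventually_elim simp
  ultimately show ?thesis
    using assms(3) Lim_transform_eventually by fastforce
qed

text \<open>An upper bound on \<open>s + t\<close> that is asymptotically sharp, together with \<open>(s + t)\<^sup>2 = 4 * s * t + (s - t)\<^sup>2\<close>, makes
  every slack term in the lower bound for \<open>s * t\<close> tend to \<open>0\<close>. The hypothesis \<open>orient\<close> says \<open>X \<le> Y\<close> and
  selects one of the two optimal configurations.\<close>

lemma profile_limits:
  fixes \<beta> :: real and w1 w2 h1 h2 x y g :: "nat \<Rightarrow> real"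
  assumes \<beta>: "0 < \<beta>" "\<beta> \<le> 1 / 2"
    and x: "\<forall>\<^sub>F n in sequentially. 0 \<le> x n \<and> x n \<le> w1 n \<and> x n \<le> w2 n"
    and y: "\<forall>\<^sub>F n in sequentially. 0 \<le> y n \<and> y n \<le> h1 n \<and> y n \<le> h2 n"
    and pos: "\<forall>\<^sub>F n in sequentially. 0 < w1 n \<and> 0 < w2 n \<and> 0 < h1 n \<and> 0 < h2 n"
    and area1: "\<forall>\<^sub>F n in sequentially. 1 \<le> w1 n * h1 n"
    and area2: "\<forall>\<^sub>F n in sequentially. 1 \<le> w2 n * h2 n"
    and area: "\<forall>\<^sub>F n in sequentially. 1 + x n * y n \<le> (w1 n * h1 n) * (w2 n * h2 n)"
    and orient: "\<forall>\<^sub>F n in sequentially. x n * (h1 n + h2 n) \<le> y n * (w1 n + w2 n)"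
    and energy: "\<forall>\<^sub>F n in sequentially. w1 n + w2 n + h1 n + h2 n - \<beta> * (x n + y n) \<le> g n"
    and g: "g \<longlonglongrightarrow> 2 * sqrt (4 - 2 * \<beta>)"
  defines "a \<equiv> sqrt (4 - 2 * \<beta>) / 2" and "b \<equiv> 2 / sqrt (4 - 2 * \<beta>)"
  shows "w1 \<longlonglongrightarrow> a" "w2 \<longlonglongrightarrow> a" "h1 \<longlonglongrightarrow> b" "h2 \<longlonglongrightarrow> b" "x \<longlonglongrightarrow> 0" "y \<longlonglongrightarrow> b"
proof -
  define c where "c = 4 - 2 * \<beta>"
  have c: "c > 0" using \<beta> by (simp add: c_def)
  have sc: "sqrt c * sqrt c = c" "sqrt c > 0" using c by auto
  define X Y where "X n = 2 * x n / (w1 n + w2 n)" and "Y n = 2 * y n / (h1 n + h2 n)" for n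
  define s t where "s n = w1 n + w2 n - \<beta> * x n" and "t n = h1 n + h2 n - \<beta> * y n" for n
  define \<delta> where "\<delta> n = (g n)\<^sup>2 - 4 * c" for n
  have \<delta>: "\<delta> \<longlonglongrightarrow> 0"
  proof -
    have "\<delta> \<longlonglongrightarrow> (2 * sqrt c)\<^sup>2 - 4 * c"
      unfolding \<delta>_def using g by (intro tendsto_intros) (simp add: c_def)
    then show ?thesis using c by simp
  qed
  have XY01: "\<forall>\<^sub>F n in sequentially. 0 \<le> X n \<and> X n \<le> Y n \<and> Y n \<le> 1"
    using x y pos orient
  proof eventually_elim
    case (elim n)
    then have "x n / (w1 n + w2 n) \<le> y n / (h1 n + h2 n)"
      by (subst frac_le_eq) (auto simp: divide_simps mult_ac)
    then show ?case
      using elim by (auto simp: X_def Y_def)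
  qed
  have main: "\<forall>\<^sub>F n in sequentially. 0 < s n \<and> 0 < t n \<and> s n + t n \<le> g n
      \<and> c + 2 * \<beta> * ((1 - X n) * (1 - Y n)) + 3 / 8 * (X n * Y n) \<le> s n * t n"
    using x y pos area energy
  proof eventually_elim
    case (elim n)
    have "\<beta> * x n \<le> 1 * w1 n" "\<beta> * y n \<le> 1 * h1 n"
      using elim \<beta> by (intro mult_mono; simp)+
    then have "0 < s n" "0 < t n" using elim by (auto simp: s_def t_def)
    moreover have "s n + t n \<le> g n" using elim by (simp add: s_def t_def algebra_simps)
    ultimately show ?case
      using profile_inequality[OF \<beta>, of "x n" "w1 n" "w2 n" "y n" "h1 n" "h2 n"] elim
      by (simp add: s_def t_def X_def Y_def c_def)
  qed
  have bounds: "\<forall>\<^sub>F n in sequentially. (s n - t n)\<^sup>2 \<le> \<delta> n \<and> 0 \<le> s n * t n - c \<and> s n * t n - c \<le> \<delta> n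
      \<and> (1 - X n) * (1 - Y n) \<le> \<delta> n / \<beta> \<and> X n * Y n \<le> 3 * \<delta> n"
    using main XY01
  proof eventually_elim
    case (elim n)
    have "(s n + t n)\<^sup>2 \<le> (g n)\<^sup>2"
      using elim by (intro power_mono) auto
    then have *: "(s n - t n)\<^sup>2 + 4 * (s n * t n - c) \<le> \<delta> n"
      by (simp add: \<delta>_def power2_eq_square algebra_simps)
    define p q d where "p = (1 - X n) * (1 - Y n)" and "q = X n * Y n" and "d = (s n - t n)\<^sup>2"
    have nn: "0 \<le> p" "0 \<le> q" "0 \<le> d" "0 \<le> \<beta> * p"
      using elim \<beta> by (auto simp: p_def q_def d_def)
    have st: "c + 2 * (\<beta> * p) + 3 / 8 * q \<le> s n * t n"
      using elim by (simp add: p_def q_def)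
    have "d \<le> \<delta> n" "0 \<le> s n * t n - c" "s n * t n - c \<le> \<delta> n" "\<beta> * p \<le> \<delta> n" "q \<le> 3 * \<delta> n"
      using nn st *[folded d_def] by argo+
    moreover from this(4) have "p \<le> \<delta> n / \<beta>"
      using \<beta> by (simp add: pos_le_divide_eq mult_ac)
    ultimately show ?case
      by (simp add: p_def q_def d_def)
  qed
  have XY: "(\<lambda>n. X n * Y n) \<longlonglongrightarrow> 0"
  proof (rule tendsto_sandwich[OF _ _ tendsto_const])
    show "(\<lambda>n. 3 * \<delta> n) \<longlonglongrightarrow> 0" using tendsto_mult_right_zero[OF \<delta>] by simp
    show "\<forall>\<^sub>F n in sequentially. 0 \<le> X n * Y n" using XY01 by eventually_elim auto
    show "\<forall>\<^sub>F n in sequentially. X n * Y n \<le> 3 * \<delta> n" using bounds by eventually_elim auto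
  qed
  have XY': "(\<lambda>n. (1 - X n) * (1 - Y n)) \<longlonglongrightarrow> 0"
  proof (rule tendsto_sandwich[OF _ _ tendsto_const])
    show "(\<lambda>n. \<delta> n / \<beta>) \<longlonglongrightarrow> 0" using tendsto_divide_zero[OF \<delta>] by simp
    show "\<forall>\<^sub>F n in sequentially. 0 \<le> (1 - X n) * (1 - Y n)" using XY01 by eventually_elim auto
    show "\<forall>\<^sub>F n in sequentially. (1 - X n) * (1 - Y n) \<le> \<delta> n / \<beta>" using bounds by eventually_elim auto
  qed
  have sum: "(\<lambda>n. X n + Y n) \<longlonglongrightarrow> 1"
    using tendsto_diff[OF tendsto_add[OF tendsto_const[of 1] XY] XY'] by (simp add: algebra_simps)
  have diff: "(\<lambda>n. Y n - X n) \<longlonglongrightarrow> 1"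
  proof (rule tendsto_of_power2_tendsto)
    have "(\<lambda>n. (X n + Y n)\<^sup>2 - 4 * (X n * Y n)) \<longlonglongrightarrow> 1\<^sup>2 - 4 * 0"
      by (intro tendsto_intros sum XY)
    then show "(\<lambda>n. (Y n - X n)\<^sup>2) \<longlonglongrightarrow> 1\<^sup>2"
      by (simp add: power2_eq_square algebra_simps)
    show "\<forall>\<^sub>F n in sequentially. 0 \<le> Y n - X n" using XY01 by eventually_elim auto
  qed simp
  have Y: "Y \<longlonglongrightarrow> 1"
    using tendsto_divide[OF tendsto_add[OF sum diff] tendsto_const[of 2]] by simp
  have X: "X \<longlonglongrightarrow> 0"
    using tendsto_diff[OF sum Y] by simp
  have st2: "(\<lambda>n. (s n - t n)\<^sup>2) \<longlonglongrightarrow> 0"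
  proof (rule tendsto_sandwich[OF _ _ tendsto_const \<delta>])
    show "\<forall>\<^sub>F n in sequentially. (s n - t n)\<^sup>2 \<le> \<delta> n" using bounds by eventually_elim auto
  qed simp
  then have st: "(\<lambda>n. s n - t n) \<longlonglongrightarrow> 0"
    by simp
  have stc: "(\<lambda>n. s n * t n) \<longlonglongrightarrow> c"
  proof -
    have "(\<lambda>n. s n * t n - c) \<longlonglongrightarrow> 0"
    proof (rule tendsto_sandwich[OF _ _ tendsto_const \<delta>])
      show "\<forall>\<^sub>F n in sequentially. 0 \<le> s n * t n - c" using bounds by eventually_elim auto
      show "\<forall>\<^sub>F n in sequentially. s n * t n - c \<le> \<delta> n" using bounds by eventually_elim auto
    qed
    then show ?thesis by (simp add: LIM_zero_iff)
  qed
  have spt: "(\<lambda>n. s n + t n) \<longlonglongrightarrow> 2 * sqrt c"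
  proof (rule tendsto_of_power2_tendsto)
    have "(\<lambda>n. (s n - t n)\<^sup>2 + 4 * (s n * t n)) \<longlonglongrightarrow> 0 + 4 * c"
      by (intro tendsto_intros st2 stc)
    moreover have "(2 * sqrt c)\<^sup>2 = 0 + 4 * c" "(s n - t n)\<^sup>2 + 4 * (s n * t n) = (s n + t n)\<^sup>2" for n
      using c by (simp_all add: power_mult_distrib power2_sum power2_diff)
    ultimately show "(\<lambda>n. (s n + t n)\<^sup>2) \<longlonglongrightarrow> (2 * sqrt c)\<^sup>2"
      by simp
    show "\<forall>\<^sub>F n in sequentially. 0 \<le> s n + t n" using main by eventually_elim auto
  qed (use c in simp)
  have s: "s \<longlonglongrightarrow> sqrt c" and t: "t \<longlonglongrightarrow> sqrt c"
    using tendsto_divide[OF tendsto_add[OF spt st] tendsto_const[of 2]]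
      tendsto_divide[OF tendsto_diff[OF spt st] tendsto_const[of 2]] by simp_all
  have W: "(\<lambda>n. w1 n + w2 n) \<longlonglongrightarrow> sqrt c"
  proof -
    have "(\<lambda>n. s n / (1 - \<beta> * X n / 2)) \<longlonglongrightarrow> sqrt c / (1 - \<beta> * 0 / 2)"
      by (intro tendsto_intros s X) auto
    moreover have "\<forall>\<^sub>F n in sequentially. s n / (1 - \<beta> * X n / 2) = w1 n + w2 n"
      using XY01 pos
    proof eventually_elim
      case (elim n)
      have "\<beta> * X n \<le> 1 * 1" using elim \<beta> by (intro mult_mono) auto
      moreover have "s n = (w1 n + w2 n) * (1 - \<beta> * X n / 2)"
        using elim by (simp add: s_def X_def field_simps)
      ultimately show ?case by simp
    qed
    ultimately show ?thesis using Lim_transform_eventually by fastforce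
  qed
  have H: "(\<lambda>n. h1 n + h2 n) \<longlonglongrightarrow> sqrt c / (1 - \<beta> / 2)"
  proof -
    have "(\<lambda>n. t n / (1 - \<beta> * Y n / 2)) \<longlonglongrightarrow> sqrt c / (1 - \<beta> * 1 / 2)"
      using \<beta> by (intro tendsto_intros t Y) auto
    moreover have "\<forall>\<^sub>F n in sequentially. t n / (1 - \<beta> * Y n / 2) = h1 n + h2 n"
      using XY01 pos
    proof eventually_elim
      case (elim n)
      have "\<beta> * Y n \<le> 1 * 1" using elim \<beta> by (intro mult_mono) auto
      moreover have "t n = (h1 n + h2 n) * (1 - \<beta> * Y n / 2)"
        using elim by (simp add: t_def Y_def field_simps)
      ultimately show ?case by simp
    qed
    ultimately show ?thesis using Lim_transform_eventually by fastforce
  qed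
  have Hb: "sqrt c / (1 - \<beta> / 2) = 2 * b"
  proof -
    have "1 - \<beta> / 2 = sqrt c * sqrt c / 4" unfolding sc(1) by (simp add: c_def)
    then show ?thesis
      unfolding b_def c_def[symmetric] using sc(2) \<beta> by (simp add: divide_simps del: real_sqrt_mult_self)
  qed
  have ab: "1 / b = a" "2 * a = sqrt c" "b > 0"
    using sc by (auto simp: a_def b_def c_def)
  have H: "(\<lambda>n. h1 n + h2 n) \<longlonglongrightarrow> 2 * b" using H Hb by simp
  have W: "(\<lambda>n. w1 n + w2 n) \<longlonglongrightarrow> 2 * a" using W ab by simp
  show x0: "x \<longlonglongrightarrow> 0"
  proof -
    have "(\<lambda>n. X n * (w1 n + w2 n) / 2) \<longlonglongrightarrow> 0 * (2 * a) / 2" by (intro tendsto_intros X W) simp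
    moreover have "\<forall>\<^sub>F n in sequentially. X n * (w1 n + w2 n) / 2 = x n"
      using pos by eventually_elim (auto simp: X_def)
    ultimately show ?thesis using Lim_transform_eventually by fastforce
  qed
  show y: "y \<longlonglongrightarrow> b"
  proof -
    have "(\<lambda>n. Y n * (h1 n + h2 n) / 2) \<longlonglongrightarrow> 1 * (2 * b) / 2" by (intro tendsto_intros Y H) simp
    moreover have "\<forall>\<^sub>F n in sequentially. Y n * (h1 n + h2 n) / 2 = y n"
      using pos by eventually_elim (auto simp: Y_def)
    ultimately show ?thesis using Lim_transform_eventually by fastforce
  qed
  have Hy: "(\<lambda>n. h1 n + h2 n - y n) \<longlonglongrightarrow> b" using tendsto_diff[OF H y] by simp
  show h1: "h1 \<longlonglongrightarrow> b"
  proof (rule tendsto_sandwich[OF _ _ y Hy])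
    show "\<forall>\<^sub>F n in sequentially. y n \<le> h1 n" "\<forall>\<^sub>F n in sequentially. h1 n \<le> h1 n + h2 n - y n"
      using assms(4) by (eventually_elim, simp)+
  qed
  show h2: "h2 \<longlonglongrightarrow> b"
    using tendsto_diff[OF H h1] by simp
  have i1: "(\<lambda>n. 1 / h1 n) \<longlonglongrightarrow> a" and i2: "(\<lambda>n. 1 / h2 n) \<longlonglongrightarrow> a"
    using tendsto_divide[OF tendsto_const[of 1] h1] tendsto_divide[OF tendsto_const[of 1] h2] ab by auto
  have Wi: "(\<lambda>n. w1 n + w2 n - 1 / h2 n) \<longlonglongrightarrow> a" using tendsto_diff[OF W i2] by simp
  show w1: "w1 \<longlonglongrightarrow> a"
  proof (rule tendsto_sandwich[OF _ _ i1 Wi])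
    show "\<forall>\<^sub>F n in sequentially. 1 / h1 n \<le> w1 n"
      using pos area1 by eventually_elim (auto simp: divide_simps mult_ac)
    show "\<forall>\<^sub>F n in sequentially. w1 n \<le> w1 n + w2 n - 1 / h2 n"
      using pos area2 by eventually_elim (simp add: pos_divide_le_eq)
  qed
  show "w2 \<longlonglongrightarrow> a"
    using tendsto_diff[OF W w1] by simp
qed

section \<open>Nearly optimal pairs are nearly adjacent rectangles\<close>

lemma ex_le_average:
  fixes f :: "'a \<Rightarrow> real"
  assumes "finite S" "S \<noteq> {}" "sum f S \<le> m"
  obtains s where "s \<in> S" "real (card S) * f s \<le> m"
proof (rule ccontr)
  assume "\<not> thesis"
  then have "\<And>s. s \<in> S \<Longrightarrow> m < real (card S) * f s"
    using that by force
  then have "(\<Sum>s\<in>S. m) < (\<Sum>s\<in>S. real (card S) * f s)"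
    using assms by (intro sum_strict_mono) auto
  then have "real (card S) * m < real (card S) * sum f S"
    by (simp add: sum_distrib_left)
  also have "\<dots> \<le> real (card S) * m"
    using assms(3) by (intro mult_left_mono) auto
  finally show False by simp
qed

definition box_deficit :: "lattice set \<Rightarrow> real" where
  "box_deficit A = real (card (fst ` A)) * real (card (snd ` A)) - real (card A)"

lemma box_deficit_eq_sum_hslice:
  assumes "finite A"
  shows "box_deficit A = (\<Sum>j\<in>snd ` A. real (card (fst ` A)) - real (card (hslice j A)))"
  using card_eq_sum_hslice[of A "snd ` A"] assms
  by (simp add: box_deficit_def sum_subtractf)

lemma box_deficit_eq_sum_vslice:
  assumes "finite A"
  shows "box_deficit A = (\<Sum>i\<in>fst ` A. real (card (snd ` A)) - real (card (vslice i A)))"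
  using card_eq_sum_vslice[of A "fst ` A"] assms
  by (simp add: box_deficit_def sum_subtractf)

lemma card_hslice_le: "finite A \<Longrightarrow> card (hslice j A) \<le> card (fst ` A)"
  and card_vslice_le: "finite A \<Longrightarrow> card (vslice i A) \<le> card (snd ` A)"
  by (simp_all add: card_mono hslice_subset vslice_subset)

lemma box_deficit_nonneg: "finite A \<Longrightarrow> 0 \<le> box_deficit A"
  by (simp add: box_deficit_eq_sum_hslice sum_nonneg card_hslice_le)

text \<open>At least \<open>g\<close> rows meet both sets and are rigid. The numbers of points that the rows of \<open>A\<close> lack to fill
  the first projection of \<open>A\<close> add up to the deficit of \<open>A\<close>, and similarly for \<open>B\<close>; so the best of these rows lacks at most
  the \<open>g\<close>-th part of the total deficit.\<close>

lemma ex_rigid_nearly_full_row: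
  fixes \<beta> g :: real
  assumes "finite A" "finite B" "A \<inter> B = {}" "0 < \<beta>" "\<beta> \<le> 1 / 2" "0 < g"
    and g: "g \<le> card (snd ` A \<inter> snd ` B) - (P \<beta> A B - projection_bound \<beta> A B) / (2 * \<beta>)"
  obtains j where "j \<in> snd ` A" "j \<in> snd ` B"
    "line_energy \<beta> (hslice j A) (hslice j B) < line_bound \<beta> (hslice j A) (hslice j B) + 2 * \<beta>"
    "g * (real (card (fst ` A)) - card (hslice j A)) \<le> box_deficit A + box_deficit B"
    "g * (real (card (fst ` B)) - card (hslice j B)) \<le> box_deficit A + box_deficit B"
proof -
  let ?bad = "{j \<in> snd ` (A \<union> B).
      line_bound \<beta> (hslice j A) (hslice j B) + 2 * \<beta> \<le> line_energy \<beta> (hslice j A) (hslice j B)}"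
  let ?dA = "\<lambda>j. real (card (fst ` A)) - card (hslice j A)"
    and ?dB = "\<lambda>j. real (card (fst ` B)) - card (hslice j B)"
  define G where "G = (snd ` A \<inter> snd ` B) - ?bad"
  have fin: "finite G" "finite ?bad" using assms by (auto simp: G_def)
  have d: "0 \<le> ?dA j" "0 \<le> ?dB j" for j
    using assms card_hslice_le by auto
  have "real (card ?bad) \<le> (P \<beta> A B - projection_bound \<beta> A B) / (2 * \<beta>)"
    using bad_lines_le(1)[of A B \<beta>] assms by (simp add: pos_le_divide_eq mult_ac)
  moreover have "card (snd ` A \<inter> snd ` B) \<le> card G + card ?bad"
    unfolding G_def using diff_card_le_card_Diff[OF fin(2), of "snd ` A \<inter> snd ` B"] by linarith
  ultimately have gG: "g \<le> card G" using g by linarith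
  then have ne: "G \<noteq> {}" using \<open>0 < g\<close> by auto
  have "(\<Sum>j\<in>G. ?dA j + ?dB j) = (\<Sum>j\<in>G. ?dA j) + (\<Sum>j\<in>G. ?dB j)"
    by (rule sum.distrib)
  also have "\<dots> \<le> (\<Sum>j\<in>snd ` A. ?dA j) + (\<Sum>j\<in>snd ` B. ?dB j)"
    using assms d by (intro add_mono sum_mono2) (auto simp: G_def)
  also have "\<dots> = box_deficit A + box_deficit B"
    using assms by (simp add: box_deficit_eq_sum_hslice)
  finally obtain j where j: "j \<in> G" "card G * (?dA j + ?dB j) \<le> box_deficit A + box_deficit B"
    using ex_le_average[OF fin(1) ne] by blast
  have "g * ?dA j \<le> card G * (?dA j + ?dB j)" "g * ?dB j \<le> card G * (?dA j + ?dB j)"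
    using d gG \<open>0 < g\<close> by (intro mult_mono; simp)+
  then show ?thesis
    using j that[of j] by (auto simp: G_def)
qed

text \<open>The same averaging over the columns that meet \<open>A\<close> and not \<open>B\<close>.\<close>

lemma ex_rigid_nearly_full_column:
  fixes \<beta> g :: real
  assumes "finite A" "finite B" "A \<inter> B = {}" "0 < \<beta>" "\<beta> \<le> 1 / 2" "0 < g"
    and g: "g \<le> real (card (fst ` A)) - card (fst ` A \<inter> fst ` B)
      - (P \<beta> A B - projection_bound \<beta> A B) / (2 * \<beta>)"
  obtains i where "i \<in> fst ` A" "i \<notin> fst ` B"
    "line_energy \<beta> (vslice i A) (vslice i B) < line_bound \<beta> (vslice i A) (vslice i B) + 2 * \<beta>"
    "g * (real (card (snd ` A)) - card (vslice i A)) \<le> box_deficit A"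
proof -
  let ?bad = "{i \<in> fst ` (A \<union> B).
      line_bound \<beta> (vslice i A) (vslice i B) + 2 * \<beta> \<le> line_energy \<beta> (vslice i A) (vslice i B)}"
  let ?d = "\<lambda>i. real (card (snd ` A)) - card (vslice i A)"
  define G where "G = (fst ` A - fst ` A \<inter> fst ` B) - ?bad"
  have fin: "finite G" "finite ?bad" using assms by (auto simp: G_def)
  have d: "0 \<le> ?d i" for i
    using assms card_vslice_le by auto
  have "real (card ?bad) \<le> (P \<beta> A B - projection_bound \<beta> A B) / (2 * \<beta>)"
    using bad_lines_le(2)[of A B \<beta>] assms by (simp add: pos_le_divide_eq mult_ac)
  moreover have "card (fst ` A) - card (fst ` A \<inter> fst ` B) \<le> card G + card ?bad"
    unfolding G_def using diff_card_le_card_Diff[OF fin(2), of "fst ` A - fst ` A \<inter> fst ` B"]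
      diff_card_le_card_Diff[of "fst ` A \<inter> fst ` B" "fst ` A"] assms by simp
  moreover have "card (fst ` A \<inter> fst ` B) \<le> card (fst ` A)"
    using assms by (intro card_mono) auto
  ultimately have gG: "g \<le> card G" using g by linarith
  then have ne: "G \<noteq> {}" using \<open>0 < g\<close> by auto
  have "(\<Sum>i\<in>G. ?d i) \<le> (\<Sum>i\<in>fst ` A. ?d i)"
    using assms d by (intro sum_mono2) (auto simp: G_def)
  also have "\<dots> = box_deficit A"
    using assms by (simp add: box_deficit_eq_sum_vslice)
  finally obtain i where i: "i \<in> G" "card G * ?d i \<le> box_deficit A"
    using ex_le_average[OF fin(1) ne] by blast
  have "g * ?d i \<le> card G * ?d i"
    using d gG \<open>0 < g\<close> by (intro mult_right_mono) simp_all
  then show ?thesis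
    using i that[of i] by (auto simp: G_def)
qed

lemma translation_isometry: "(\<lambda>(i, j). (i - m, j - n)) \<in> lattice_isometries"
proof -
  have "(\<lambda>(i, j). (i - m, j - n)) = (\<lambda>z. z + (- m, - n))" by (auto simp: fun_eq_iff)
  then show ?thesis using lattice_isometries.translation[of "(- m, - n)"] by simp
qed

lemma reflected_translation_isometry: "(\<lambda>(i, j). (m - i, j - n)) \<in> lattice_isometries"
proof -
  have "(\<lambda>(i, j). (m - i, j - n)) = (\<lambda>(i, j). (i - (- m), j - n)) \<circ> (\<lambda>(i, j). (- i, j))"
    by (auto simp: fun_eq_iff)
  then show ?thesis
    using lattice_isometries.comp[OF translation_isometry lattice_isometries.reflection2] by metis
qed

lemma card_outside_le:
  fixes F S :: "int set" and g d :: real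
  assumes "finite F" "S \<subseteq> F" "inj \<sigma>" "\<sigma> ` S \<subseteq> I"
    and "g * (real (card F) - card S) \<le> d" "0 \<le> g"
  shows "g * card (\<sigma> ` F - I) \<le> d"
proof -
  have "card (\<sigma> ` F - I) \<le> card (\<sigma> ` (F - S))"
    using assms by (intro card_mono) auto
  also have "\<dots> = card (F - S)" using assms(3) by (intro card_image) (auto simp: inj_on_def)
  also have "\<dots> = card F - card S" using assms by (intro card_Diff_subset finite_subset[OF assms(2,1)]) 
  finally have "real (card (\<sigma> ` F - I)) \<le> real (card F) - card S"
    using card_mono[OF assms(1,2)] by linarith
  then have "g * card (\<sigma> ` F - I) \<le> g * (real (card F) - card S)"
    using assms(6) by (rule mult_left_mono)
  then show ?thesis using assms(5) by simp
qed

text \<open>A rigid nearly full row fixes the horizontal position: \<open>T\<close> moves the contact point of the two intervals in it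
  to the origin and reflects if \<open>A\<close> is on the right. A rigid nearly full column of \<open>A\<close> fixes the vertical position.
  The intervals ending at \<open>0\<close> and starting at \<open>1\<close> match cells that have their points as upper right corners.
  Since \<open>T\<close> acts on the two coordinates separately, what the projections contain beyond these intervals is
  controlled by the deficits.\<close>

lemma near_adjacent_rectangles:
  fixes \<beta> g :: real and A B :: "lattice set"
  assumes "finite A" "finite B" "A \<inter> B = {}" "0 < \<beta>" "\<beta> \<le> 1 / 2" "0 < g"
    and gr: "g \<le> card (snd ` A \<inter> snd ` B) - (P \<beta> A B - projection_bound \<beta> A B) / (2 * \<beta>)"
    and gc: "g \<le> real (card (fst ` A)) - card (fst ` A \<inter> fst ` B)
      - (P \<beta> A B - projection_bound \<beta> A B) / (2 * \<beta>)"
  defines "D \<equiv> box_deficit A + box_deficit B"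
  obtains T where "T \<in> lattice_isometries" "inj T"
    "card (fst ` T ` A) = card (fst ` A)" "card (snd ` T ` A) = card (snd ` A)"
    "card (fst ` T ` B) = card (fst ` B)" "card (snd ` T ` B) = card (snd ` B)"
    "g * card (fst ` T ` A - {1 - int (card (fst ` A))..0}) \<le> D"
    "g * card (fst ` T ` B - {1..int (card (fst ` B))}) \<le> D"
    "g * card (snd ` T ` A - {1..int (card (snd ` A))}) \<le> D"
    "g * card (snd ` T ` B - {1..int (card (snd ` A))})
      \<le> D + g * (real (card (snd ` B)) - card (snd ` A \<inter> snd ` B))"
proof -
  obtain j where j: "j \<in> snd ` A" "j \<in> snd ` B"
    "line_energy \<beta> (hslice j A) (hslice j B) < line_bound \<beta> (hslice j A) (hslice j B) + 2 * \<beta>"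
    "g * (real (card (fst ` A)) - card (hslice j A)) \<le> D"
    "g * (real (card (fst ` B)) - card (hslice j B)) \<le> D"
    using ex_rigid_nearly_full_row[OF assms(1-6) gr] unfolding D_def by metis
  obtain i where i: "i \<in> fst ` A" "i \<notin> fst ` B"
    "line_energy \<beta> (vslice i A) (vslice i B) < line_bound \<beta> (vslice i A) (vslice i B) + 2 * \<beta>"
    "g * (real (card (snd ` A)) - card (vslice i A)) \<le> box_deficit A"
    using ex_rigid_nearly_full_column[OF assms(1-6) gc] by metis
  have D: "box_deficit A \<le> D" using box_deficit_nonneg[OF assms(2)] by (simp add: D_def)
  have fin: "finite (hslice j A)" "finite (hslice j B)" "finite (vslice i A)"
    using assms finite_hslice finite_vslice by auto
  have ne: "hslice j A \<noteq> {}" "hslice j B \<noteq> {}" "vslice i A \<noteq> {}" "vslice i B = {}"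
    using i j by (auto simp: hslice_eq_empty_iff vslice_eq_empty_iff)
  obtain n where n: "vslice i A = {n + 1..n + int (card (vslice i A))}"
    using line_energy_rigid_single[OF fin(3) ne(3) assms(5)] i(3) ne(4) by metis
  have le: "card (hslice j A) \<le> card (fst ` A)" "card (hslice j B) \<le> card (fst ` B)"
    "card (vslice i A) \<le> card (snd ` A)"
    using assms card_hslice_le card_vslice_le by auto
  obtain \<sigma> where iso: "(\<lambda>(i, j). (\<sigma> i, j - n)) \<in> lattice_isometries" and \<sigma>: "inj \<sigma>"
    and A: "\<sigma> ` hslice j A \<subseteq> {1 - int (card (fst ` A))..0}"
    and B: "\<sigma> ` hslice j B \<subseteq> {1..int (card (fst ` B))}"
    using line_energy_rigid[OF fin(1,2) hslice_disjoint[OF assms(3)] assms(5) ne(1,2) j(3)]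
  proof cases
    case (1 m)
    have "(\<lambda>i. i - m) ` hslice j A \<subseteq> {1 - int (card (fst ` A))..0}"
      by (subst 1(1)) (use le in auto)
    moreover have "(\<lambda>i. i - m) ` hslice j B \<subseteq> {1..int (card (fst ` B))}"
      by (subst 1(2)) (use le in auto)
    ultimately show ?thesis
      using that[of "\<lambda>i. i - m"] translation_isometry by (simp add: inj_on_def)
  next
    case (2 m)
    have "(\<lambda>i. m + 1 - i) ` hslice j A \<subseteq> {1 - int (card (fst ` A))..0}"
      by (subst 2(2)) (use le in auto)
    moreover have "(\<lambda>i. m + 1 - i) ` hslice j B \<subseteq> {1..int (card (fst ` B))}"
      by (subst 2(1)) (use le in auto)
    ultimately show ?thesis
      using that[of "\<lambda>i. m + 1 - i"] reflected_translation_isometry by (simp add: inj_on_def)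
  qed
  define T where "T = (\<lambda>(i, j). (\<sigma> i, j - n))"
  define \<tau> where "\<tau> = (\<lambda>j. j - n)"
  have \<tau>: "inj \<tau>" by (auto simp: \<tau>_def inj_on_def)
  have fst: "fst ` T ` C = \<sigma> ` fst ` C" and snd: "snd ` T ` C = \<tau> ` snd ` C" for C
    by (force simp: T_def \<tau>_def image_image)+
  have "inj T"
    using \<sigma> by (auto simp: T_def inj_on_def)
  moreover have "g * card (fst ` T ` A - {1 - int (card (fst ` A))..0}) \<le> D"
    unfolding fst using assms j A \<sigma> by (intro card_outside_le[OF _ hslice_subset]) auto
  moreover have "g * card (fst ` T ` B - {1..int (card (fst ` B))}) \<le> D"
    unfolding fst using assms j B \<sigma> by (intro card_outside_le[OF _ hslice_subset]) auto
  moreover have snd_le: "g * card (snd ` T ` A - {1..int (card (snd ` A))}) \<le> D"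
    unfolding snd
  proof (rule card_outside_le[OF _ vslice_subset \<tau>])
    show "\<tau> ` vslice i A \<subseteq> {1..int (card (snd ` A))}"
      by (subst n) (use le in \<open>auto simp: \<tau>_def\<close>)
  qed (use assms i D in auto)
  moreover have "g * card (snd ` T ` B - {1..int (card (snd ` A))})
      \<le> D + g * (real (card (snd ` B)) - card (snd ` A \<inter> snd ` B))"
  proof -
    let ?I = "{1..int (card (snd ` A))}"
    have "snd ` B \<subseteq> snd ` A \<union> (snd ` B - snd ` A \<inter> snd ` B)" by blast
    from image_mono[OF this, of \<tau>]
    have "snd ` T ` B - ?I \<subseteq> (snd ` T ` A - ?I) \<union> \<tau> ` (snd ` B - snd ` A \<inter> snd ` B)"
      unfolding snd image_Un by blast
    then have "card (snd ` T ` B - ?I) \<le> card ((snd ` T ` A - ?I) \<union> \<tau> ` (snd ` B - snd ` A \<inter> snd ` B))"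
      using assms(1,2) by (intro card_mono) simp_all
    also have "\<dots> \<le> card (snd ` T ` A - ?I) + card (\<tau> ` (snd ` B - snd ` A \<inter> snd ` B))"
      by (rule card_Un_le)
    also have "card (\<tau> ` (snd ` B - snd ` A \<inter> snd ` B)) = card (snd ` B - snd ` A \<inter> snd ` B)"
      using \<tau> by (intro card_image) (auto simp: inj_on_def)
    also have "\<dots> = card (snd ` B) - card (snd ` A \<inter> snd ` B)"
      using assms by (intro card_Diff_subset) auto
    finally have "real (card (snd ` T ` B - ?I))
        \<le> card (snd ` T ` A - ?I) + (real (card (snd ` B)) - card (snd ` A \<inter> snd ` B))"
      using card_mono[of "snd ` B" "snd ` A \<inter> snd ` B"] assms by (simp add: of_nat_diff)
    then have "g * card (snd ` T ` B - ?I)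
        \<le> g * (card (snd ` T ` A - ?I) + (real (card (snd ` B)) - card (snd ` A \<inter> snd ` B)))"
      using \<open>0 < g\<close> by (intro mult_left_mono) auto
    then show ?thesis
      using snd_le by (simp add: distrib_left)
  qed
  moreover have "card (fst ` T ` C) = card (fst ` C)" "card (snd ` T ` C) = card (snd ` C)" for C
    unfolding fst snd by (simp_all only: card_image inj_on_subset[OF \<sigma>] inj_on_subset[OF \<tau>] subset_UNIV)
  ultimately show ?thesis
    using that[of T] iso[folded T_def] by blast
qed

text \<open>Here \<open>i\<close> stands for the unit interval from \<open>i - 1\<close> to \<open>i\<close>. If this is not contained in the real interval from
  \<open>l\<close> to \<open>u\<close>, then \<open>i\<close> lies outside the integer interval or near one of the two ends.\<close>

lemma card_outside_real_interval_le:
  fixes X :: "int set" and l u :: real and p :: int and w :: nat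
  assumes "finite X"
  shows "card {i \<in> X. \<not> (l \<le> of_int i - 1 \<and> of_int i \<le> u)}
    \<le> card (X - {p + 1..p + int w}) + \<bar>p - l\<bar> + \<bar>p + w - u\<bar> + 2"
proof -
  have "{i \<in> X. \<not> (l \<le> of_int i - 1 \<and> of_int i \<le> u)}
    \<subseteq> (X - {p + 1..p + int w}) \<union> {p + 1..\<lceil>l\<rceil>} \<union> {\<lfloor>u\<rfloor> + 1..p + int w}"
    by (auto simp: le_ceiling_iff floor_less_iff add1_zle_eq)
  then have "card {i \<in> X. \<not> (l \<le> of_int i - 1 \<and> of_int i \<le> u)}
    \<le> card ((X - {p + 1..p + int w}) \<union> {p + 1..\<lceil>l\<rceil>} \<union> {\<lfloor>u\<rfloor> + 1..p + int w})"
    using assms by (intro card_mono) auto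
  also have "\<dots> \<le> card (X - {p + 1..p + int w}) + card {p + 1..\<lceil>l\<rceil>} + card {\<lfloor>u\<rfloor> + 1..p + int w}"
    by (intro order_trans[OF card_Un_le] add_mono card_Un_le order_refl)
  finally have "real (card {i \<in> X. \<not> (l \<le> of_int i - 1 \<and> of_int i \<le> u)})
    \<le> card (X - {p + 1..p + int w}) + real (nat (\<lceil>l\<rceil> - p)) + real (nat (p + w - \<lfloor>u\<rfloor>))"
    by simp
  moreover have "real (nat (\<lceil>l\<rceil> - p)) \<le> \<bar>p - l\<bar> + 1" by linarith
  moreover have "real (nat (p + w - \<lfloor>u\<rfloor>)) \<le> \<bar>p + w - u\<bar> + 1" by linarith
  ultimately show ?thesis by linarith
qed

section \<open>Proportions of nearly optimal pairs\<close>

text \<open>The hypotheses of \<open>profile_limits\<close>, with lengths measured in units of \<open>sqrt N\<close>, are the slicing bound and the counting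
  inequality.\<close>

lemma limits_of_nearly_optimal_profiles:
  fixes \<beta> :: real and A B :: "nat \<Rightarrow> lattice set"
  assumes \<beta>: "0 < \<beta>" "\<beta> \<le> 1 / 2"
    and adm: "\<And>N. N \<ge> 1 \<Longrightarrow> admissible N (A N) (B N)"
    and energy: "\<And>N. N \<ge> 1 \<Longrightarrow> P \<beta> (A N) (B N) \<le> 4 * sqrt (4 - 2 * \<beta>) * sqrt N + 8"
    and orient: "\<And>N. N \<ge> 1 \<Longrightarrow>
      card (fst ` A N \<inter> fst ` B N) * (card (snd ` A N) + card (snd ` B N))
      \<le> card (snd ` A N \<inter> snd ` B N) * (card (fst ` A N) + card (fst ` B N))"
  defines "a \<equiv> sqrt (4 - 2 * \<beta>) / 2" and "b \<equiv> 2 / sqrt (4 - 2 * \<beta>)"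
  shows "(\<lambda>N. card (fst ` A N) / sqrt N) \<longlonglongrightarrow> a" "(\<lambda>N. card (fst ` B N) / sqrt N) \<longlonglongrightarrow> a"
    "(\<lambda>N. card (snd ` A N) / sqrt N) \<longlonglongrightarrow> b" "(\<lambda>N. card (snd ` B N) / sqrt N) \<longlonglongrightarrow> b"
    "(\<lambda>N. card (fst ` A N \<inter> fst ` B N) / sqrt N) \<longlonglongrightarrow> 0"
    "(\<lambda>N. card (snd ` A N \<inter> snd ` B N) / sqrt N) \<longlonglongrightarrow> b"
proof -
  have fin: "finite (A N)" "finite (B N)" "A N \<inter> B N = {}" "card (A N) = N" "card (B N) = N"
    if "N \<ge> 1" for N
    using adm[OF that] by (auto simp: admissible_def)
  have ev: "\<forall>\<^sub>F N in sequentially. R N" if "\<And>N. N \<ge> 1 \<Longrightarrow> R N" for R :: "nat \<Rightarrow> bool"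
    using eventually_ge_at_top[of 1] by eventually_elim (rule that)
  have sq: "sqrt (real N) > 0" "sqrt (real N) * sqrt (real N) = real N" if "N \<ge> 1" for N
    using that by auto
  define g where "g N = 2 * sqrt (4 - 2 * \<beta>) + 4 * (1 / sqrt (real N))" for N
  have g: "g \<longlonglongrightarrow> 2 * sqrt (4 - 2 * \<beta>)"
  proof -
    have "(\<lambda>N. 1 / sqrt (real N)) \<longlonglongrightarrow> 0"
      using lim_1_over_n[THEN tendsto_real_sqrt] by (simp add: real_sqrt_divide)
    from tendsto_add[OF tendsto_const tendsto_mult[OF tendsto_const this]]
    show ?thesis unfolding g_def by fastforce
  qed
  let ?w1 = "\<lambda>N. card (fst ` A N) / sqrt N" and ?w2 = "\<lambda>N. card (fst ` B N) / sqrt N"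
    and ?h1 = "\<lambda>N. card (snd ` A N) / sqrt N" and ?h2 = "\<lambda>N. card (snd ` B N) / sqrt N"
    and ?x = "\<lambda>N. card (fst ` A N \<inter> fst ` B N) / sqrt N"
    and ?y = "\<lambda>N. card (snd ` A N \<inter> snd ` B N) / sqrt N"
  have Int_le: "card (S \<inter> S') \<le> card S" "card (S \<inter> S') \<le> card S'" if "finite S" "finite S'" for S S' :: "int set"
    using that by (simp_all add: card_mono)
  have 1: "\<forall>\<^sub>F N in sequentially. 0 \<le> ?x N \<and> ?x N \<le> ?w1 N \<and> ?x N \<le> ?w2 N"
    using Int_le fin(1,2) by (intro ev) (simp add: divide_right_mono)
  have 2: "\<forall>\<^sub>F N in sequentially. 0 \<le> ?y N \<and> ?y N \<le> ?h1 N \<and> ?y N \<le> ?h2 N"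
    using Int_le fin(1,2) by (intro ev) (simp add: divide_right_mono)
  have 3: "\<forall>\<^sub>F N in sequentially. 0 < ?w1 N \<and> 0 < ?w2 N \<and> 0 < ?h1 N \<and> 0 < ?h2 N"
  proof (rule ev)
    fix N :: nat assume N: "N \<ge> 1"
    have "A N \<noteq> {}" "B N \<noteq> {}" using fin[OF N] N by auto
    then show "0 < ?w1 N \<and> 0 < ?w2 N \<and> 0 < ?h1 N \<and> 0 < ?h2 N"
      using fin[OF N] N by (simp add: card_gt_0_iff)
  qed
  have 4: "\<forall>\<^sub>F N in sequentially. 1 \<le> ?w1 N * ?h1 N" "\<forall>\<^sub>F N in sequentially. 1 \<le> ?w2 N * ?h2 N"
  proof -
    have "1 \<le> card (fst ` V) / sqrt N * (card (snd ` V) / sqrt N)"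
      if "N \<ge> 1" "finite V" "card V = N" for V :: "lattice set" and N
      using box_deficit_nonneg[OF that(2)] that sq[OF that(1)]
      by (simp add: box_deficit_def le_divide_eq)
    then show "\<forall>\<^sub>F N in sequentially. 1 \<le> ?w1 N * ?h1 N" "\<forall>\<^sub>F N in sequentially. 1 \<le> ?w2 N * ?h2 N"
      using fin by (auto intro!: ev)
  qed
  have 5: "\<forall>\<^sub>F N in sequentially. 1 + ?x N * ?y N \<le> (?w1 N * ?h1 N) * (?w2 N * ?h2 N)"
  proof (rule ev)
    fix N :: nat assume N: "N \<ge> 1"
    let ?X = "real (card (fst ` A N \<inter> fst ` B N))" and ?Y = "real (card (snd ` A N \<inter> snd ` B N))"
    let ?M = "real (card (fst ` A N)) * card (snd ` A N) * (real (card (fst ` B N)) * card (snd ` B N))"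
    have "(real N)\<^sup>2 + N * (?X * ?Y) \<le> ?M"
      using projections_product_ge[OF fin[OF N]] by (simp only: flip: of_nat_mult of_nat_add of_nat_power of_nat_le_iff)
    then have "((real N)\<^sup>2 + N * (?X * ?Y)) / (real N)\<^sup>2 \<le> ?M / (real N)\<^sup>2"
      by (rule divide_right_mono) simp
    moreover have "((real N)\<^sup>2 + N * (?X * ?Y)) / (real N)\<^sup>2 = 1 + ?X * ?Y / N"
      using N by (simp add: field_simps power2_eq_square)
    moreover have "?x N * ?y N = ?X * ?Y / N" "(?w1 N * ?h1 N) * (?w2 N * ?h2 N) = ?M / (real N)\<^sup>2"
      by (simp_all add: power2_eq_square)
    ultimately show "1 + ?x N * ?y N \<le> (?w1 N * ?h1 N) * (?w2 N * ?h2 N)"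
      by (simp only:)
  qed
  have 6: "\<forall>\<^sub>F N in sequentially. ?x N * (?h1 N + ?h2 N) \<le> ?y N * (?w1 N + ?w2 N)"
  proof (rule ev)
    fix N :: nat assume N: "N \<ge> 1"
    have "real (card (fst ` A N \<inter> fst ` B N)) * (card (snd ` A N) + real (card (snd ` B N)))
      \<le> card (snd ` A N \<inter> snd ` B N) * (card (fst ` A N) + real (card (fst ` B N)))"
      using orient[OF N] by (simp only: flip: of_nat_mult of_nat_add of_nat_le_iff)
    then show "?x N * (?h1 N + ?h2 N) \<le> ?y N * (?w1 N + ?w2 N)"
      by (simp add: divide_right_mono flip: add_divide_distrib)
  qed
  have 7: "\<forall>\<^sub>F N in sequentially. ?w1 N + ?w2 N + ?h1 N + ?h2 N - \<beta> * (?x N + ?y N) \<le> g N"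
  proof (rule ev)
    fix N :: nat assume N: "N \<ge> 1"
    have "projection_bound \<beta> (A N) (B N) \<le> P \<beta> (A N) (B N)"
      using projection_bound_le_P[OF fin(1-3)[OF N], of \<beta>] \<beta> by simp
    then have "projection_bound \<beta> (A N) (B N) / (2 * sqrt N) \<le> (4 * sqrt (4 - 2 * \<beta>) * sqrt N + 8) / (2 * sqrt N)"
      using energy[OF N] by (intro divide_right_mono) auto
    also have "\<dots> = g N" using sq[OF N] by (simp add: g_def field_simps)
    also have "projection_bound \<beta> (A N) (B N) / (2 * sqrt N)
      = ?w1 N + ?w2 N + ?h1 N + ?h2 N - \<beta> * (?x N + ?y N)"
      using sq[OF N] by (simp add: projection_bound_def add_divide_distrib diff_divide_distrib distrib_left)
    finally show "?w1 N + ?w2 N + ?h1 N + ?h2 N - \<beta> * (?x N + ?y N) \<le> g N" .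
  qed
  from profile_limits[OF \<beta> 1 2 3 4 5 6 7 g]
  show "?w1 \<longlonglongrightarrow> a" "?w2 \<longlonglongrightarrow> a" "?h1 \<longlonglongrightarrow> b" "?h2 \<longlonglongrightarrow> b" "?x \<longlonglongrightarrow> 0" "?y \<longlonglongrightarrow> b"
    by (simp_all add: a_def b_def)
qed

section \<open>Weak-* limits of sets that nearly fill a rectangle\<close>

text \<open>The open square of side \<open>1 / s\<close> whose upper right corner is the rescaled point \<open>z\<close>; open, so that the cells of
  distinct lattice points are disjoint.\<close>

definition cell :: "real \<Rightarrow> lattice \<Rightarrow> (real \<times> real) set" where
  "cell s z = box (lattice_embed (z - (1, 1)) /\<^sub>R s) (lattice_embed z /\<^sub>R s)"

lemma mem_cell_iff:
  assumes "s > 0"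
  shows "(u, v) \<in> cell s (i, j) \<longleftrightarrow>
    of_int i - 1 < s * u \<and> s * u < of_int i \<and> of_int j - 1 < s * v \<and> s * v < of_int j"
  using assms by (auto simp: cell_def lattice_embed_def box_prod field_simps)

lemma cell_eq_times:
  assumes "s > 0"
  shows "cell s (i, j) = {(of_int i - 1) / s<..<of_int i / s} \<times> {(of_int j - 1) / s<..<of_int j / s}"
  using assms by (auto simp: mem_cell_iff field_simps)

lemma disjoint_cells:
  assumes "s > 0" "z \<noteq> z'"
  shows "cell s z \<inter> cell s z' = {}"
proof (rule ccontr)
  assume "cell s z \<inter> cell s z' \<noteq> {}"
  then obtain u v where uv: "(u, v) \<in> cell s z" "(u, v) \<in> cell s z'" by force
  obtain i j i' j' where z: "z = (i, j)" "z' = (i', j')" by (metis prod.exhaust)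
  have "of_int i - 1 < s * u" "s * u < of_int i" "of_int j - 1 < s * v" "s * v < of_int j"
    "of_int i' - 1 < s * u" "s * u < of_int i'" "of_int j' - 1 < s * v" "s * v < of_int j'"
    using uv unfolding z mem_cell_iff[OF assms(1)] by auto
  then have "i = i'" "j = j'" by linarith+
  then show False using assms(2) z by simp
qed

lemma emeasure_lborel_box_prod:
  fixes a b c d :: real
  assumes "a \<le> b" "c \<le> d"
  shows "emeasure lborel ({a<..<b} \<times> {c<..<d}) = ennreal ((b - a) * (d - c))"
  using assms
  by (simp add: lborel_prod[symmetric] lborel.emeasure_pair_measure_Times ennreal_mult)

lemma cell_borel [measurable]: "cell s z \<in> sets borel"
  by (simp add: cell_def)

lemma emeasure_cell:
  assumes "s > 0"
  shows "emeasure lborel (cell s z) = ennreal (1 / s\<^sup>2)"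
proof -
  obtain i j where z: "z = (i, j)" by force
  have "of_int i / s - (of_int i - 1) / s = 1 / s" for i :: int
    by (simp add: diff_divide_distrib)
  then show ?thesis
    using assms unfolding z cell_eq_times[OF assms]
    by (subst emeasure_lborel_box_prod) (auto simp: divide_right_mono power2_eq_square)
qed

lemma abs_set_integral_le:
  fixes f :: "'a \<Rightarrow> real"
  assumes "set_integrable M S f" "S \<in> sets M" "emeasure M S < \<infinity>" "\<And>x. x \<in> S \<Longrightarrow> \<bar>f x\<bar> \<le> b"
  shows "\<bar>LINT x:S|M. f x\<bar> \<le> b * measure M S"
proof -
  have c: "set_integrable M S (\<lambda>_. b)" "set_integrable M S (\<lambda>_. - b)"
    using assms unfolding set_integrable_def by (auto intro!: integrable_real_indicator integrable_mult_left)
  have "(LINT x:S|M. f x) \<le> (LINT x:S|M. b)"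
    using assms c by (intro set_integral_mono) (auto simp: abs_le_iff)
  moreover have "(LINT x:S|M. - b) \<le> (LINT x:S|M. f x)"
    using assms c by (intro set_integral_mono) (auto simp: abs_le_iff dest: assms(4))
  ultimately show ?thesis
    using assms by (simp add: set_integral_const mult.commute abs_le_iff)
qed

lemma integral_empirical_measure:
  assumes "finite V" and f: "f \<in> borel_measurable borel"
  shows "integral\<^sup>L (empirical_measure V) f
    = (\<Sum>z\<in>V. f (lattice_embed z /\<^sub>R sqrt (real (card V)))) / card V"
proof -
  let ?g = "\<lambda>x. lattice_embed x /\<^sub>R sqrt (real (card V))"
  have "?g \<in> uniform_count_measure V \<rightarrow>\<^sub>M borel"
    by (auto simp: measurable_def sets_uniform_count_measure space_uniform_count_measure)
  then show ?thesis
    unfolding empirical_measure_def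
    by (simp add: integral_distr f integral_uniform_count_measure assms)
qed

lemma integral_lebesgue_restricted:
  fixes f :: "real \<times> real \<Rightarrow> real"
  assumes "S \<in> sets borel" "f \<in> borel_measurable borel"
  shows "integral\<^sup>L (lebesgue_restricted S) f = (LINT x:S|lborel. f x)"
proof -
  have "lebesgue_restricted S = density lborel (\<lambda>x. ennreal (indicator S x))"
    by (simp add: lebesgue_restricted_def ennreal_indicator)
  then show ?thesis
    unfolding set_lebesgue_integral_def using assms by (simp add: integral_density)
qed

lemma bounded_if_tendsto_0_at_infinity:
  fixes f :: "real \<times> real \<Rightarrow> real"
  assumes "continuous_on UNIV f" "(f \<longlongrightarrow> 0) at_infinity"
  obtains b where "b > 0" "\<And>x. \<bar>f x\<bar> \<le> b"
proof -
  have "eventually (\<lambda>x. norm (f x) < 1) at_infinity"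
    using assms(2) order_tendstoD(2)[OF tendsto_norm_zero[OF assms(2)], of 1] by simp
  then obtain r where r: "\<And>x. r \<le> norm x \<Longrightarrow> norm (f x) < 1"
    by (auto simp: eventually_at_infinity)
  have "compact (f ` cball 0 r)"
    using assms(1) by (intro compact_continuous_image continuous_on_subset[OF assms(1)]) auto
  then obtain b where b: "\<And>x. x \<in> cball 0 r \<Longrightarrow> norm (f x) \<le> b"
    by (meson bounded_iff compact_imp_bounded imageI)
  have "\<bar>f x\<bar> \<le> max b 1" for x
    using r[of x] b[of x] by (cases "r \<le> norm x") auto
  then show ?thesis using that[of "max b 1"] by simp
qed

lemma cell_value_approx:
  fixes f :: "real \<times> real \<Rightarrow> real"
  assumes s: "s > 0" and int: "set_integrable lborel (cell s z) f"
    and near: "\<And>x. x \<in> cell s z \<Longrightarrow> \<bar>f (lattice_embed z /\<^sub>R s) - f x\<bar> \<le> e"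
  shows "\<bar>f (lattice_embed z /\<^sub>R s) / s\<^sup>2 - (LINT x:cell s z|lborel. f x)\<bar> \<le> e / s\<^sup>2"
proof -
  let ?c = "f (lattice_embed z /\<^sub>R s)"
  have fin: "emeasure lborel (cell s z) < \<infinity>" and m: "measure lborel (cell s z) = 1 / s\<^sup>2"
    using emeasure_cell[OF s, of z] by (simp_all add: measure_def)
  have const: "set_integrable lborel (cell s z) (\<lambda>_. ?c)"
    using fin unfolding set_integrable_def
    by (intro integrable_scaleR_left integrable_real_indicator) auto
  have "(LINT x:cell s z|lborel. ?c - f x) = ?c / s\<^sup>2 - (LINT x:cell s z|lborel. f x)"
    using set_integral_diff(2)[OF const int] fin m by (simp add: set_integral_const)
  moreover have "\<bar>LINT x:cell s z|lborel. ?c - f x\<bar> \<le> e * measure lborel (cell s z)"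
    using set_integral_diff(1)[OF const int] fin near by (intro abs_set_integral_le) auto
  ultimately show ?thesis
    using m by simp
qed

lemma corner_mem_closure_cell:
  assumes "s > 0"
  shows "lattice_embed z /\<^sub>R s \<in> closure (cell s z)"
proof -
  have "cell s z \<noteq> {}"
    using emeasure_cell[OF assms, of z] assms by auto
  then have "closure (cell s z) = cbox (lattice_embed (z - (1, 1)) /\<^sub>R s) (lattice_embed z /\<^sub>R s)"
    unfolding cell_def by (rule closure_box)
  also have "lattice_embed z /\<^sub>R s \<in> \<dots>"
    using assms by (simp add: cbox_prod lattice_embed_def mult_left_mono)
  finally show ?thesis .
qed

lemma dist_corner_le:
  assumes "s > 0" "x \<in> cell s z"
  shows "dist (lattice_embed z /\<^sub>R s) x \<le> 2 / s"
proof -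
  obtain u v i j where xz: "x = (u, v)" "z = (i, j)" by (metis prod.exhaust)
  have uv: "of_int i - 1 < s * u" "s * u < of_int i" "of_int j - 1 < s * v" "s * v < of_int j"
    using assms(2) unfolding xz mem_cell_iff[OF assms(1)] by auto
  have *: "dist (k / s) t \<le> 1 / s" if "k - 1 < s * t" "s * t < k" for k t
  proof -
    have "k / s - t = (k - s * t) / s" using assms(1) by (simp add: diff_divide_distrib)
    then show ?thesis
      using that assms(1) by (simp add: dist_real_def divide_right_mono)
  qed
  have "dist (of_int i / s) u \<le> 1 / s" "dist (of_int j / s) v \<le> 1 / s"
    using *[of "of_int i" u] *[of "of_int j" v] uv by auto
  moreover have "lattice_embed z /\<^sub>R s = (of_int i / s, of_int j / s)"
    by (simp add: xz lattice_embed_def divide_inverse mult.commute)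
  then have "dist (lattice_embed z /\<^sub>R s) x \<le> dist (of_int i / s) u + dist (of_int j / s) v"
    unfolding xz by (simp add: dist_prod_def sqrt_sum_squares_le_sum)
  ultimately show ?thesis by simp
qed

text \<open>Let \<open>G\<close> consist of the points whose cells lie in \<open>R\<close>, and \<open>F\<close> of the others. A point of \<open>G\<close> contributes the
  integral over its cell up to \<open>e / N\<close>. As both \<open>R\<close> and the union of all cells have measure \<open>1\<close>, the part of
  \<open>R\<close> that the cells of \<open>G\<close> leave uncovered has measure \<open>card F / N\<close>, and so have the cells of \<open>F\<close>.\<close>

lemma empirical_integral_approx:
  fixes f :: "real \<times> real \<Rightarrow> real"
  assumes fin: "finite V" and N: "card V = N" "N \<ge> 1"
    and R: "open R" "emeasure lborel R = 1" "set_integrable lborel R f"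
    and f [measurable]: "f \<in> borel_measurable borel" and b: "\<And>x. \<bar>f x\<bar> \<le> b"
    and near: "\<And>x y. x \<in> closure R \<Longrightarrow> y \<in> closure R \<Longrightarrow> dist y x \<le> 2 / sqrt N \<Longrightarrow> \<bar>f y - f x\<bar> \<le> e"
    and "e \<ge> 0"
  shows "\<bar>integral\<^sup>L (empirical_measure V) f - integral\<^sup>L (lebesgue_restricted R) f\<bar>
    \<le> e + 2 * b * (card {z \<in> V. \<not> cell (sqrt N) z \<subseteq> R} / N)"
proof -
  define s where "s = sqrt (real N)"
  have s: "s > 0" "s\<^sup>2 = N" using N by (auto simp: s_def)
  define G where "G = {z \<in> V. cell s z \<subseteq> R}"
  define F where "F = {z \<in> V. \<not> cell s z \<subseteq> R}"
  define U where "U = (\<Union>z\<in>G. cell s z)"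
  let ?p = "\<lambda>z. lattice_embed z /\<^sub>R s"
  have finV: "finite G" "finite F"
    using fin by (auto simp: G_def F_def)
  have split: "V = G \<union> F" "G \<inter> F = {}" by (auto simp: G_def F_def)
  have cardN: "real (card G) + card F = N"
    using card_Un_disjoint[OF finV split(2)] split(1) N(1) by (simp flip: of_nat_add)
  have [measurable]: "R \<in> sets borel" using R by simp
  have U: "U \<subseteq> R" "U \<in> sets borel"
    using finV by (auto simp: U_def G_def)
  have int: "set_integrable lborel S f" if "S \<subseteq> R" "S \<in> sets borel" for S
    using R(3) that by (intro set_integrable_subset[OF R(3)]) simp_all
  have disj: "disjoint_family_on (cell s) G"
    using disjoint_cells[OF s(1)] by (auto simp: disjoint_family_on_def)
  have mcell: "measure lborel (cell s z) = 1 / N" for z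
    using emeasure_cell[OF s(1), of z] by (simp add: measure_def s)
  have "measure lborel U = (\<Sum>z\<in>G. measure lborel (cell s z))"
    unfolding U_def using finV disj emeasure_cell[OF s(1)]
    by (intro measure_finite_Union) auto
  then have mU: "measure lborel U = card G / N" using mcell by simp
  have mR: "measure lborel R = 1" using R by (simp add: measure_def)
  have mRU: "measure lborel (R - U) = card F / N"
  proof -
    have "measure lborel (R - U) = measure lborel R - measure lborel U"
      using U R by (intro measure_Diff) auto
    also have "\<dots> = (real N - card G) / N"
      using mR mU N by (simp add: diff_divide_distrib)
    finally show ?thesis
      using cardN by (simp add: algebra_simps)
  qed
  have fRU: "emeasure lborel (R - U) < \<infinity>"
  proof -
    have "emeasure lborel (R - U) \<le> emeasure lborel R" by (rule emeasure_mono) auto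
    also have "\<dots> < \<infinity>" using R by simp
    finally show ?thesis .
  qed
  have "(LINT x:R|lborel. f x) = (LINT x:U \<union> (R - U)|lborel. f x)"
    using U by (simp add: Un_absorb1)
  also have "\<dots> = (LINT x:U|lborel. f x) + (LINT x:R - U|lborel. f x)"
    using U by (intro set_integral_Un int) auto
  also have "(LINT x:U|lborel. f x) = (\<Sum>z\<in>G. LINT x:cell s z|lborel. f x)"
    unfolding U_def using finV disj int by (intro set_integral_finite_Union) (auto simp: G_def)
  finally have R_eq: "(LINT x:R|lborel. f x)
    = (\<Sum>z\<in>G. LINT x:cell s z|lborel. f x) + (LINT x:R - U|lborel. f x)" .
  have "integral\<^sup>L (empirical_measure V) f = (\<Sum>z\<in>V. f (?p z)) / N"
    using integral_empirical_measure[OF fin f] N(1) by (simp add: s_def)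
  also have "\<dots> = (\<Sum>z\<in>V. f (?p z) / N)" by (rule sum_divide_distrib)
  also have "\<dots> = (\<Sum>z\<in>G. f (?p z) / N) + (\<Sum>z\<in>F. f (?p z) / N)"
    unfolding split(1) by (rule sum.union_disjoint[OF finV split(2)])
  finally have E_eq: "integral\<^sup>L (empirical_measure V) f
    = (\<Sum>z\<in>G. f (?p z) / N) + (\<Sum>z\<in>F. f (?p z) / N)" .
  have "\<bar>f (?p z) / N - (LINT x:cell s z|lborel. f x)\<bar> \<le> e / N" if "z \<in> G" for z
  proof -
    have sub: "cell s z \<subseteq> R" using that by (simp add: G_def)
    have "?p z \<in> closure R"
      using closure_mono[OF sub] corner_mem_closure_cell[OF s(1)] by blast
    moreover have "x \<in> closure R" if "x \<in> cell s z" for x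
      using that sub closure_subset[of R] by blast
    ultimately have "\<bar>f (?p z) - f x\<bar> \<le> e" if "x \<in> cell s z" for x
      using near[of x "?p z"] dist_corner_le[OF s(1) that] that by (simp add: s_def)
    then show ?thesis
      using cell_value_approx[OF s(1) int[OF sub], of e] by (simp add: s(2))
  qed
  then have "\<bar>\<Sum>z\<in>G. f (?p z) / N - (LINT x:cell s z|lborel. f x)\<bar> \<le> (\<Sum>z\<in>G. e / N)"
    by (intro order_trans[OF sum_abs] sum_mono)
  also have "\<dots> = e * (card G / N)" by simp
  also have "\<dots> \<le> e * 1"
    using cardN N(2) assms(10) by (intro mult_left_mono) (auto simp: divide_le_eq_1)
  finally have 1: "\<bar>\<Sum>z\<in>G. f (?p z) / N - (LINT x:cell s z|lborel. f x)\<bar> \<le> e" by simp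
  have "\<bar>\<Sum>z\<in>F. f (?p z) / N\<bar> \<le> (\<Sum>z\<in>F. b / N)"
    using b by (intro order_trans[OF sum_abs] sum_mono) (simp add: divide_right_mono)
  then have 2: "\<bar>\<Sum>z\<in>F. f (?p z) / N\<bar> \<le> b * (card F / N)" by (simp add: mult_ac)
  have "\<bar>LINT x:R - U|lborel. f x\<bar> \<le> b * measure lborel (R - U)"
    using U b fRU by (intro abs_set_integral_le int) auto
  then have 3: "\<bar>LINT x:R - U|lborel. f x\<bar> \<le> b * (card F / N)"
    by (simp only: mRU)
  have "integral\<^sup>L (empirical_measure V) f - (LINT x:R|lborel. f x)
    = (\<Sum>z\<in>G. f (?p z) / N - (LINT x:cell s z|lborel. f x))
      + (\<Sum>z\<in>F. f (?p z) / N) - (LINT x:R - U|lborel. f x)"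
    unfolding E_eq R_eq sum_subtractf by simp
  then have "\<bar>integral\<^sup>L (empirical_measure V) f - (LINT x:R|lborel. f x)\<bar> \<le> e + 2 * (b * (card F / N))"
    using 1 2 3 by linarith
  then show ?thesis
    by (simp add: integral_lebesgue_restricted F_def s_def mult.assoc)
qed

lemma weak_star_convergent_of_cells:
  assumes fin: "\<And>N. N \<ge> 1 \<Longrightarrow> finite (V N)" and card: "\<And>N. N \<ge> 1 \<Longrightarrow> card (V N) = N"
    and R: "open R" "bounded R" "emeasure lborel R = 1"
    and out: "(\<lambda>N. card {z \<in> V N. \<not> cell (sqrt N) z \<subseteq> R} / real N) \<longlonglongrightarrow> 0"
  shows "weak_star_convergent (\<lambda>N. empirical_measure (V N)) (lebesgue_restricted R)"
  unfolding weak_star_convergent_def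
proof (intro allI impI)
  fix f :: "real \<times> real \<Rightarrow> real"
  assume cont: "continuous_on UNIV f" and lim: "(f \<longlongrightarrow> 0) at_infinity"
  have meas: "f \<in> borel_measurable borel"
    using cont by (rule borel_measurable_continuous_onI)
  obtain b where b: "b > 0" "\<And>x. \<bar>f x\<bar> \<le> b"
    using bounded_if_tendsto_0_at_infinity[OF cont lim] by blast
  have cR: "compact (closure R)" "continuous_on (closure R) f"
    using R continuous_on_subset[OF cont] by auto
  then have "set_integrable lborel (closure R) f"
    unfolding set_integrable_def by (rule borel_integrable_compact)
  then have int: "set_integrable lborel R f"
    by (rule set_integrable_subset) (use R(1) closure_subset[of R] in auto)
  have unif: "uniformly_continuous_on (closure R) f"
    using compact_uniformly_continuous[OF cR(2,1)] .
  show "(\<lambda>N. integral\<^sup>L (empirical_measure (V N)) f) \<longlonglongrightarrow> integral\<^sup>L (lebesgue_restricted R) f"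
  proof (rule LIMSEQ_I)
    fix \<epsilon> :: real assume \<epsilon>: "\<epsilon> > 0"
    then obtain d where d: "d > 0"
      "\<And>x y. x \<in> closure R \<Longrightarrow> y \<in> closure R \<Longrightarrow> dist y x < d \<Longrightarrow> dist (f y) (f x) < \<epsilon> / 2"
      using uniformly_continuous_onE[OF unif, of "\<epsilon> / 2"] by auto
    have "(\<lambda>N. 2 * (1 / sqrt (real N))) \<longlonglongrightarrow> 2 * 0"
      by (intro tendsto_mult tendsto_const lim_1_over_n[THEN tendsto_real_sqrt, simplified real_sqrt_divide real_sqrt_one real_sqrt_zero])
    then have "\<forall>\<^sub>F N in sequentially. 2 / sqrt (real N) < d"
      using d(1) order_tendstoD(2)[of "\<lambda>N. 2 / sqrt (real N)" 0] by simp
    moreover have "\<forall>\<^sub>F N in sequentially. card {z \<in> V N. \<not> cell (sqrt N) z \<subseteq> R} / real N < \<epsilon> / (4 * b)"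
      using order_tendstoD(2)[OF out] \<epsilon> b by simp
    moreover have "\<forall>\<^sub>F N in sequentially. N \<ge> (1::nat)"
      by (rule eventually_ge_at_top)
    ultimately have "\<forall>\<^sub>F N in sequentially.
      norm (integral\<^sup>L (empirical_measure (V N)) f - integral\<^sup>L (lebesgue_restricted R) f) < \<epsilon>"
    proof eventually_elim
      case (elim N)
      have near: "\<bar>f y - f x\<bar> \<le> \<epsilon> / 2"
        if "x \<in> closure R" "y \<in> closure R" "dist y x \<le> 2 / sqrt N" for x y
        using d(2)[OF that(1,2)] that(3) elim(1) by (simp add: dist_real_def)
      have "2 * b * (card {z \<in> V N. \<not> cell (sqrt N) z \<subseteq> R} / N) < 2 * b * (\<epsilon> / (4 * b))"
        using elim(2) b(1) by (intro mult_strict_left_mono) auto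
      also have "\<dots> = \<epsilon> / 2" using b(1) by simp
      finally show ?case
        using empirical_integral_approx[OF fin[OF elim(3)] card[OF elim(3)] elim(3) R(1,3) int meas b(2)
            near] \<epsilon> by simp
    qed
    then show "\<exists>N0. \<forall>N\<ge>N0.
      norm (integral\<^sup>L (empirical_measure (V N)) f - integral\<^sup>L (lebesgue_restricted R) f) < \<epsilon>"
      by (simp add: eventually_sequentially)
  qed
qed

lemma weak_star_convergent_of_rectangle:
  fixes l1 u1 l2 u2 :: real
  assumes "\<And>N. N \<ge> 1 \<Longrightarrow> finite (V N)" "\<And>N. N \<ge> 1 \<Longrightarrow> card (V N) = N"
    and "l1 \<le> u1" "l2 \<le> u2" "(u1 - l1) * (u2 - l2) = 1"
    and "(\<lambda>N. card {z \<in> V N. \<not> cell (sqrt N) z \<subseteq> {l1<..<u1} \<times> {l2<..<u2}} / real N) \<longlonglongrightarrow> 0"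
  shows "weak_star_convergent (\<lambda>N. empirical_measure (V N)) (lebesgue_restricted ({l1<..<u1} \<times> {l2<..<u2}))"
  using assms by (intro weak_star_convergent_of_cells)
    (auto simp: open_Times bounded_Times emeasure_lborel_box_prod)

lemma card_cells_outside_le:
  fixes V :: "lattice set" and p q :: int and w h :: nat and l1 u1 l2 u2 dx dy s :: real
  assumes fin: "finite V" and s: "s > 0"
    and dx: "card (fst ` V - {p + 1..p + int w}) \<le> dx"
    and dy: "card (snd ` V - {q + 1..q + int h}) \<le> dy"
  shows "card {z \<in> V. \<not> cell s z \<subseteq> {l1<..<u1} \<times> {l2<..<u2}}
    \<le> (dx + \<bar>p - l1 * s\<bar> + \<bar>p + w - u1 * s\<bar> + 2) * card (snd ` V)
      + card (fst ` V) * (dy + \<bar>q - l2 * s\<bar> + \<bar>q + h - u2 * s\<bar> + 2)"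
proof -
  let ?X = "{i \<in> fst ` V. \<not> (l1 * s \<le> of_int i - 1 \<and> of_int i \<le> u1 * s)}"
  let ?Y = "{j \<in> snd ` V. \<not> (l2 * s \<le> of_int j - 1 \<and> of_int j \<le> u2 * s)}"
  have sub: "{z \<in> V. \<not> cell s z \<subseteq> {l1<..<u1} \<times> {l2<..<u2}} \<subseteq> ?X \<times> (snd ` V) \<union> (fst ` V) \<times> ?Y"
  proof (rule subsetI, rule ccontr)
    fix z assume z: "z \<in> {z \<in> V. \<not> cell s z \<subseteq> {l1<..<u1} \<times> {l2<..<u2}}"
      and n: "z \<notin> ?X \<times> (snd ` V) \<union> (fst ` V) \<times> ?Y"
    obtain i j where ij: "z = (i, j)" by (rule prod.exhaust)
    have "i \<in> fst ` V" "j \<in> snd ` V" using z ij by force+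
    then have "l1 * s \<le> of_int i - 1" "of_int i \<le> u1 * s" "l2 * s \<le> of_int j - 1" "of_int j \<le> u2 * s"
      using n ij by auto
    then have "l1 \<le> (of_int i - 1) / s" "of_int i / s \<le> u1" "l2 \<le> (of_int j - 1) / s" "of_int j / s \<le> u2"
      using s by (simp_all add: pos_le_divide_eq pos_divide_le_eq)
    then have "cell s z \<subseteq> {l1<..<u1} \<times> {l2<..<u2}"
      unfolding ij cell_eq_times[OF s] by (intro Sigma_mono) auto
    then show False using z by simp
  qed
  have "card {z \<in> V. \<not> cell s z \<subseteq> {l1<..<u1} \<times> {l2<..<u2}}
      \<le> card (?X \<times> (snd ` V) \<union> (fst ` V) \<times> ?Y)"
    using sub fin by (intro card_mono) auto
  also have "\<dots> \<le> card ?X * card (snd ` V) + card (fst ` V) * card ?Y"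
    by (rule order_trans[OF card_Un_le]) (simp add: card_cartesian_product)
  finally have "card {z \<in> V. \<not> cell s z \<subseteq> {l1<..<u1} \<times> {l2<..<u2}}
      \<le> card ?X * card (snd ` V) + card (fst ` V) * card ?Y" .
  from of_nat_mono[OF this, where 'a = real]
  have "real (card {z \<in> V. \<not> cell s z \<subseteq> {l1<..<u1} \<times> {l2<..<u2}})
      \<le> real (card ?X) * card (snd ` V) + card (fst ` V) * real (card ?Y)"
    by (simp only: of_nat_add of_nat_mult)
  also have "\<dots> \<le> (dx + \<bar>p - l1 * s\<bar> + \<bar>p + w - u1 * s\<bar> + 2) * card (snd ` V)
      + card (fst ` V) * (dy + \<bar>q - l2 * s\<bar> + \<bar>q + h - u2 * s\<bar> + 2)"
  proof (rule add_mono)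
    have "real (card ?X) \<le> dx + \<bar>p - l1 * s\<bar> + \<bar>p + w - u1 * s\<bar> + 2"
      using card_outside_real_interval_le[of "fst ` V" "l1 * s" "u1 * s" p w] dx fin by simp
    then show "real (card ?X) * card (snd ` V)
        \<le> (dx + \<bar>p - l1 * s\<bar> + \<bar>p + w - u1 * s\<bar> + 2) * card (snd ` V)"
      by (rule mult_right_mono) simp
    have "real (card ?Y) \<le> dy + \<bar>q - l2 * s\<bar> + \<bar>q + h - u2 * s\<bar> + 2"
      using card_outside_real_interval_le[of "snd ` V" "l2 * s" "u2 * s" q h] dy fin by simp
    then show "card (fst ` V) * real (card ?Y)
        \<le> card (fst ` V) * (dy + \<bar>q - l2 * s\<bar> + \<bar>q + h - u2 * s\<bar> + 2)"
      by (rule mult_left_mono) simp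
  qed
  finally show ?thesis .
qed

section \<open>Convergence up to isometry\<close>

lemma related_pairs_image:
  assumes "\<And>c d. R (f c) (f d) \<longleftrightarrow> R c d"
  shows "{(c, d). c \<in> f ` C \<and> d \<in> f ` D \<and> R c d} = map_prod f f ` {(c, d). c \<in> C \<and> d \<in> D \<and> R c d}"
  using assms by auto

lemma Q_image:
  assumes "inj f"
    and "\<And>c d. norm (lattice_embed (f c) - lattice_embed (f d)) = norm (lattice_embed c - lattice_embed d)"
  shows "Q (f ` C) (f ` D) = Q C D"
  unfolding Q_def
    related_pairs_image[of "\<lambda>c d. norm (lattice_embed c - lattice_embed d) = 1" f, unfolded assms(2), OF refl]
  by (rule card_image, rule inj_on_subset[OF prod.inj_map[OF assms(1) assms(1)] subset_UNIV])

lemma P_rotation: "P \<beta> ((\<lambda>(x1, x2). (- x2, x1)) ` A) ((\<lambda>(x1, x2). (- x2, x1)) ` B) = P \<beta> A B"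
proof -
  let ?r = "\<lambda>(x1, x2). (- x2, x1) :: lattice"
  have bij: "bij ?r"
    by (rule bij_betw_byWitness[where f' = "\<lambda>(x1, x2). (x2, - x1)"]) auto
  have "norm (lattice_embed (?r c) - lattice_embed (?r d)) = norm (lattice_embed c - lattice_embed d)" for c d
    by (cases c; cases d)
      (simp add: lattice_embed_def norm_prod_def add.commute power2_eq_square algebra_simps)
  then have "Q (?r ` C) (?r ` D) = Q C D" for C D
    using bij_is_inj[OF bij] by (intro Q_image) 
  then show ?thesis
    unfolding P_def bij_image_Compl_eq[OF bij, symmetric] by simp
qed

lemma limit_sets:
  fixes \<beta> :: real
  assumes "\<beta> < 2"
  defines "a \<equiv> sqrt (4 - 2 * \<beta>) / 2" and "b \<equiv> 2 / sqrt (4 - 2 * \<beta>)"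
  shows "a > 0" "b > 0" "a * b = 1"
    "limit_A \<beta> = {- a<..<0} \<times> {0<..<b}" "limit_B \<beta> = {0<..<a} \<times> {0<..<b}"
proof -
  have "4 - 2 * \<beta> = 4 * ((2 - \<beta>) / 2)" by simp
  then have "sqrt (4 - 2 * \<beta>) = 2 * sqrt ((2 - \<beta>) / 2)"
    by (metis real_sqrt_four real_sqrt_mult)
  then have a: "a = sqrt ((2 - \<beta>) / 2)" and "b = 1 / sqrt ((2 - \<beta>) / 2)"
    by (simp_all add: a_def b_def)
  then have b: "b = sqrt (2 / (2 - \<beta>))" by (simp add: real_sqrt_divide)
  show "a > 0" "b > 0" "a * b = 1" using assms(1) by (auto simp: a_def b_def)
  show "limit_A \<beta> = {- a<..<0} \<times> {0<..<b}" "limit_B \<beta> = {0<..<a} \<times> {0<..<b}"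
    by (simp_all add: limit_A_def limit_B_def a b)
qed

text \<open>The number of cells of \<open>T N ` A N\<close> outside the limit rectangle is at most \<open>bA N\<close>, which is a sum of
  products of a length of order \<open>sqrt N\<close> and a length of order \<open>o (sqrt N)\<close>.\<close>

lemma weak_star_convergence_of_oriented_pairs:
  fixes \<beta> :: real and A B :: "nat \<Rightarrow> lattice set"
  assumes \<beta>: "0 < \<beta>" "\<beta> \<le> 1 / 2"
    and adm: "\<And>N. N \<ge> 1 \<Longrightarrow> admissible N (A N) (B N)"
    and energy: "\<And>N. N \<ge> 1 \<Longrightarrow> P \<beta> (A N) (B N) \<le> 4 * sqrt (4 - 2 * \<beta>) * sqrt N + 8"
    and orient: "\<And>N. N \<ge> 1 \<Longrightarrow>
      card (fst ` A N \<inter> fst ` B N) * (card (snd ` A N) + card (snd ` B N))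
      \<le> card (snd ` A N \<inter> snd ` B N) * (card (fst ` A N) + card (fst ` B N))"
  shows "\<exists>T :: nat \<Rightarrow> lattice \<Rightarrow> lattice.
    (\<forall>N. T N \<in> lattice_isometries) \<and>
    weak_star_convergent (\<lambda>N. empirical_measure (T N ` A N)) (lebesgue_restricted (limit_A \<beta>)) \<and>
    weak_star_convergent (\<lambda>N. empirical_measure (T N ` B N)) (lebesgue_restricted (limit_B \<beta>))"
proof -
  define a b where "a = sqrt (4 - 2 * \<beta>) / 2" and "b = 2 / sqrt (4 - 2 * \<beta>)"
  have "\<beta> < 2" using \<beta> by simp
  note ab = limit_sets[OF this, folded a_def b_def]
  define w1 w2 h1 h2 x y where
    "w1 N = real (card (fst ` A N))" and "w2 N = real (card (fst ` B N))" and
    "h1 N = real (card (snd ` A N))" and "h2 N = real (card (snd ` B N))" and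
    "x N = real (card (fst ` A N \<inter> fst ` B N))" and "y N = real (card (snd ` A N \<inter> snd ` B N))" for N
  note lims = limits_of_nearly_optimal_profiles[OF \<beta> adm energy orient,
      folded a_def b_def, folded w1_def w2_def h1_def h2_def x_def y_def, simplified]
  have fin: "finite (A N)" "finite (B N)" "A N \<inter> B N = {}" "card (A N) = N" "card (B N) = N"
    if "N \<ge> 1" for N
    using adm[OF that] by (auto simp: admissible_def)
  have inv: "(\<lambda>N. 1 / sqrt (real N)) \<longlonglongrightarrow> 0"
    using lim_1_over_n[THEN tendsto_real_sqrt] by (simp add: real_sqrt_divide)
  \<comment> \<open>Any constant strictly between \<open>0\<close> and \<open>min a b\<close> would do: \<open>\<kappa> * sqrt N\<close> has to stay below the number of
    rows that meet both sets and below the number of columns that meet only \<open>A\<close>.\<close>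
  define \<kappa> where "\<kappa> = min a b / 2"
  have \<kappa>: "\<kappa> > 0" "\<kappa> < a" "\<kappa> < b" using ab by (auto simp: \<kappa>_def)
  define E where "E N = P \<beta> (A N) (B N) - projection_bound \<beta> (A N) (B N)" for N
  define D where "D N = box_deficit (A N) + box_deficit (B N)" for N
  \<comment> \<open>The condition under which \<open>near_adjacent_rectangles\<close> applies with \<open>g = \<kappa> * sqrt N\<close>.\<close>
  define K where "K N \<longleftrightarrow> N \<ge> 1 \<and> \<kappa> * sqrt N \<le> y N - E N / (2 * \<beta>)
    \<and> \<kappa> * sqrt N \<le> w1 N - x N - E N / (2 * \<beta>)" for N
  \<comment> \<open>The excess \<open>E N\<close> is at most \<open>e N * sqrt N\<close>, by the upper bound on the energy.\<close>
  define e where "e N = 4 * sqrt (4 - 2 * \<beta>) + 8 * (1 / sqrt N)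
    - (2 * (w1 N / sqrt N + w2 N / sqrt N + h1 N / sqrt N + h2 N / sqrt N)
      - 2 * \<beta> * (x N / sqrt N + y N / sqrt N))" for N
  have e: "e \<longlonglongrightarrow> 0"
  proof -
    have "e \<longlonglongrightarrow> 4 * sqrt (4 - 2 * \<beta>) + 8 * 0 - (2 * (a + a + b + b) - 2 * \<beta> * (0 + b))"
      unfolding e_def by (intro tendsto_intros inv lims)
    moreover have "4 * sqrt (4 - 2 * \<beta>) + 8 * 0 - (2 * (a + a + b + b) - 2 * \<beta> * (0 + b))
        = 4 * sqrt (4 - 2 * \<beta>) - 4 * a - (4 - 2 * \<beta>) * b"
      by (simp add: algebra_simps)
    moreover have "(4 - 2 * \<beta>) * b = 2 * ((4 - 2 * \<beta>) / sqrt (4 - 2 * \<beta>))"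
      by (simp add: b_def)
    moreover have "(4 - 2 * \<beta>) / sqrt (4 - 2 * \<beta>) = sqrt (4 - 2 * \<beta>)"
      using \<beta> by (intro real_div_sqrt) simp
    moreover have "4 * a = 2 * sqrt (4 - 2 * \<beta>)"
      by (simp add: a_def)
    ultimately show ?thesis by simp
  qed
  have E_le: "E N \<le> e N * sqrt N" if "N \<ge> 1" for N
  proof -
    have "E N \<le> 4 * sqrt (4 - 2 * \<beta>) * sqrt N + 8
        - (2 * (w1 N + w2 N + h1 N + h2 N) - 2 * \<beta> * (x N + y N))"
      using energy[OF that]
      by (simp add: E_def projection_bound_def w1_def w2_def h1_def h2_def x_def y_def)
    also have "\<dots> = e N * sqrt N"
    proof -
      have "sqrt (real N) \<noteq> 0" using that by simp
      then show ?thesis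
        by (simp add: e_def left_diff_distrib distrib_right distrib_left right_diff_distrib)
    qed
    finally show ?thesis .
  qed
  have evK: "\<forall>\<^sub>F N in sequentially. K N"
  proof -
    have "(\<lambda>N. y N / sqrt N - e N / (2 * \<beta>)) \<longlonglongrightarrow> b - 0 / (2 * \<beta>)"
      using \<beta> by (intro tendsto_intros lims e) simp
    then have 1: "\<forall>\<^sub>F N in sequentially. \<kappa> < y N / sqrt N - e N / (2 * \<beta>)"
      using \<kappa> by (auto dest: order_tendstoD)
    have "(\<lambda>N. w1 N / sqrt N - x N / sqrt N - e N / (2 * \<beta>)) \<longlonglongrightarrow> a - 0 - 0 / (2 * \<beta>)"
      using \<beta> by (intro tendsto_intros lims e) simp
    then have 2: "\<forall>\<^sub>F N in sequentially. \<kappa> < w1 N / sqrt N - x N / sqrt N - e N / (2 * \<beta>)"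
      using \<kappa> by (auto dest: order_tendstoD)
    show ?thesis
      using 1 2 eventually_ge_at_top[of 1]
    proof eventually_elim
      case (elim N)
      have s: "sqrt (real N) > 0" using elim by simp
      have "E N / (2 * \<beta>) \<le> e N * sqrt N / (2 * \<beta>)"
        using E_le[OF elim(3)] \<beta> by (intro divide_right_mono) auto
      moreover have "\<kappa> * sqrt N \<le> (y N / sqrt N - e N / (2 * \<beta>)) * sqrt N"
        "\<kappa> * sqrt N \<le> (w1 N / sqrt N - x N / sqrt N - e N / (2 * \<beta>)) * sqrt N"
        using elim s by (auto intro!: mult_right_mono)
      ultimately show ?case
        using s elim(3) by (simp add: K_def left_diff_distrib)
    qed
  qed
  define r where "r N = D N / (\<kappa> * sqrt N)" for N
  define bA where "bA N = (r N + \<bar>a * sqrt N - w1 N\<bar> + 2) * h1 N + w1 N * (r N + \<bar>h1 N - b * sqrt N\<bar> + 2)" for N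
  define bB where "bB N = (r N + \<bar>w2 N - a * sqrt N\<bar> + 2) * h2 N
    + w2 N * (r N + (h2 N - y N) + \<bar>h1 N - b * sqrt N\<bar> + 2)" for N
  have "\<forall>N. \<exists>T. T \<in> lattice_isometries \<and> inj T \<and> (K N \<longrightarrow>
      card {z \<in> T ` A N. \<not> cell (sqrt N) z \<subseteq> limit_A \<beta>} \<le> bA N \<and>
      card {z \<in> T ` B N. \<not> cell (sqrt N) z \<subseteq> limit_B \<beta>} \<le> bB N)"
  proof (rule allI)
    fix N
    show "\<exists>T. T \<in> lattice_isometries \<and> inj T \<and> (K N \<longrightarrow>
      card {z \<in> T ` A N. \<not> cell (sqrt N) z \<subseteq> limit_A \<beta>} \<le> bA N \<and>
      card {z \<in> T ` B N. \<not> cell (sqrt N) z \<subseteq> limit_B \<beta>} \<le> bB N)"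
    proof (cases "K N")
      case False
      moreover have "inj (\<lambda>z :: lattice. z + 0)" by simp
      ultimately show ?thesis
        using lattice_isometries.translation[of 0] by blast
    next
      case True
      then have N: "N \<ge> 1" and s: "sqrt (real N) > 0" by (auto simp: K_def)
      have g: "0 < \<kappa> * sqrt N" using \<kappa> s by simp
      obtain T where T: "T \<in> lattice_isometries" "inj T"
        and c: "card (fst ` T ` A N) = card (fst ` A N)" "card (snd ` T ` A N) = card (snd ` A N)"
          "card (fst ` T ` B N) = card (fst ` B N)" "card (snd ` T ` B N) = card (snd ` B N)"
        and d: "\<kappa> * sqrt N * card (fst ` T ` A N - {1 - int (card (fst ` A N))..0}) \<le> D N"
          "\<kappa> * sqrt N * card (fst ` T ` B N - {1..int (card (fst ` B N))}) \<le> D N"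
          "\<kappa> * sqrt N * card (snd ` T ` A N - {1..int (card (snd ` A N))}) \<le> D N"
          "\<kappa> * sqrt N * card (snd ` T ` B N - {1..int (card (snd ` A N))})
            \<le> D N + \<kappa> * sqrt N * (real (card (snd ` B N)) - card (snd ` A N \<inter> snd ` B N))"
        using near_adjacent_rectangles[OF fin(1-3)[OF N] \<beta> g] True
        unfolding K_def D_def E_def w1_def x_def y_def by metis
      have r: "t \<le> r N" if "\<kappa> * sqrt N * t \<le> D N" for t
        using that g by (simp add: r_def pos_le_divide_eq mult.commute)
      have "card {z \<in> T ` A N. \<not> cell (sqrt N) z \<subseteq> {- a<..<0} \<times> {0<..<b}} \<le> bA N"
      proof -
        have "card (fst ` T ` A N - {- int (card (fst ` A N)) + 1..- int (card (fst ` A N)) + int (card (fst ` A N))}) \<le> r N"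
          "card (snd ` T ` A N - {0 + 1..0 + int (card (snd ` A N))}) \<le> r N"
          using r[OF d(1)] r[OF d(3)] by (simp_all add: add.commute)
        from card_cells_outside_le[OF finite_imageI[OF fin(1)[OF N]] s this, of "- a" 0 0 b]
        show ?thesis
          unfolding c by (simp add: bA_def w1_def h1_def abs_minus_commute)
      qed
      moreover have "card {z \<in> T ` B N. \<not> cell (sqrt N) z \<subseteq> {0<..<a} \<times> {0<..<b}} \<le> bB N"
      proof -
        have "\<kappa> * sqrt N * (card (snd ` T ` B N - {1..int (card (snd ` A N))}) - (h2 N - y N)) \<le> D N"
          using d(4) by (simp add: right_diff_distrib h2_def y_def)
        from r[OF this] have "card (fst ` T ` B N - {0 + 1..0 + int (card (fst ` B N))}) \<le> r N"
          "card (snd ` T ` B N - {0 + 1..0 + int (card (snd ` A N))}) \<le> r N + (h2 N - y N)"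
          using r[OF d(2)] by simp_all
        from card_cells_outside_le[OF finite_imageI[OF fin(2)[OF N]] s this, of 0 a 0 b]
        show ?thesis
          unfolding c by (simp add: bB_def w2_def h2_def h1_def)
      qed
      ultimately show ?thesis
        using T ab by auto
    qed
  qed
  from choice[OF this] obtain T where T: "\<And>N. T N \<in> lattice_isometries" "\<And>N. inj (T N)"
    and TA: "\<And>N. K N \<Longrightarrow> card {z \<in> T N ` A N. \<not> cell (sqrt N) z \<subseteq> limit_A \<beta>} \<le> bA N"
    and TB: "\<And>N. K N \<Longrightarrow> card {z \<in> T N ` B N. \<not> cell (sqrt N) z \<subseteq> limit_B \<beta>} \<le> bB N"
    by blast
  have r_lim: "(\<lambda>N. r N / sqrt N) \<longlonglongrightarrow> 0"
  proof -
    have "(\<lambda>N. ((w1 N / sqrt N) * (h1 N / sqrt N) - 1 + ((w2 N / sqrt N) * (h2 N / sqrt N) - 1)) / \<kappa>)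
      \<longlonglongrightarrow> (a * b - 1 + (a * b - 1)) / \<kappa>"
      using \<kappa> by (intro tendsto_intros lims) simp
    moreover have "\<forall>\<^sub>F N in sequentially.
      ((w1 N / sqrt N) * (h1 N / sqrt N) - 1 + ((w2 N / sqrt N) * (h2 N / sqrt N) - 1)) / \<kappa> = r N / sqrt N"
      using eventually_ge_at_top[of 1]
    proof eventually_elim
      case (elim N)
      have "D N = w1 N * h1 N - N + (w2 N * h2 N - N)"
        using fin[OF elim] by (simp add: D_def box_deficit_def w1_def h1_def w2_def h2_def)
      then have "D N / N = w1 N * h1 N / N - 1 + (w2 N * h2 N / N - 1)"
        using elim by (simp add: diff_divide_distrib add_divide_distrib)
      moreover have "r N / sqrt N = D N / N / \<kappa>"
        by (simp add: r_def mult.assoc mult.commute[of _ \<kappa>])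
      ultimately show ?case by simp
    qed
    ultimately show ?thesis
      using Lim_transform_eventually ab(3) by fastforce
  qed
  have bA_lim: "(\<lambda>N. bA N / N) \<longlonglongrightarrow> 0"
  proof -
    have "(\<lambda>N. (r N / sqrt N + \<bar>a - w1 N / sqrt N\<bar> + 2 * (1 / sqrt N)) * (h1 N / sqrt N)
        + (w1 N / sqrt N) * (r N / sqrt N + \<bar>h1 N / sqrt N - b\<bar> + 2 * (1 / sqrt N)))
      \<longlonglongrightarrow> (0 + \<bar>a - a\<bar> + 2 * 0) * b + a * (0 + \<bar>b - b\<bar> + 2 * 0)"
      by (intro tendsto_intros lims r_lim inv)
    moreover have "\<forall>\<^sub>F N in sequentially.
        (r N / sqrt N + \<bar>a - w1 N / sqrt N\<bar> + 2 * (1 / sqrt N)) * (h1 N / sqrt N)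
        + (w1 N / sqrt N) * (r N / sqrt N + \<bar>h1 N / sqrt N - b\<bar> + 2 * (1 / sqrt N)) = bA N / N"
      using eventually_ge_at_top[of 1]
    proof eventually_elim
      case (elim N)
      define s where "s = sqrt (real N)"
      have s: "s > 0" "real N = s * s" using elim by (auto simp: s_def)
      have abs: "\<bar>p / s - q\<bar> = \<bar>p - q * s\<bar> / s" for p q
      proof -
        have "p / s - q = (p - q * s) / s" using s(1) by (simp add: diff_divide_distrib)
        then show ?thesis using s(1) by simp
      qed
      then show ?case
        unfolding bA_def s_def[symmetric] abs abs_minus_commute[of a] abs_minus_commute[of "a * s"]
        unfolding s(2)
        using s(1) by (simp add: add_divide_distrib[symmetric])
    qed
    ultimately show ?thesis
      using Lim_transform_eventually by fastforce
  qed
  have bB_lim: "(\<lambda>N. bB N / N) \<longlonglongrightarrow> 0"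
  proof -
    have "(\<lambda>N. (r N / sqrt N + \<bar>w2 N / sqrt N - a\<bar> + 2 * (1 / sqrt N)) * (h2 N / sqrt N)
        + (w2 N / sqrt N) * (r N / sqrt N + (h2 N / sqrt N - y N / sqrt N) + \<bar>h1 N / sqrt N - b\<bar> + 2 * (1 / sqrt N)))
      \<longlonglongrightarrow> (0 + \<bar>a - a\<bar> + 2 * 0) * b + a * (0 + (b - b) + \<bar>b - b\<bar> + 2 * 0)"
      by (intro tendsto_intros lims r_lim inv)
    moreover have "\<forall>\<^sub>F N in sequentially.
        (r N / sqrt N + \<bar>w2 N / sqrt N - a\<bar> + 2 * (1 / sqrt N)) * (h2 N / sqrt N)
        + (w2 N / sqrt N) * (r N / sqrt N + (h2 N / sqrt N - y N / sqrt N) + \<bar>h1 N / sqrt N - b\<bar> + 2 * (1 / sqrt N))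
        = bB N / N"
      using eventually_ge_at_top[of 1]
    proof eventually_elim
      case (elim N)
      define s where "s = sqrt (real N)"
      have s: "s > 0" "real N = s * s" using elim by (auto simp: s_def)
      have abs: "\<bar>p / s - q\<bar> = \<bar>p - q * s\<bar> / s" for p q
      proof -
        have "p / s - q = (p - q * s) / s" using s(1) by (simp add: diff_divide_distrib)
        then show ?thesis using s(1) by simp
      qed
      then show ?case
        unfolding bB_def s_def[symmetric] abs unfolding s(2)
        using s(1) by (simp add: add_divide_distrib[symmetric] diff_divide_distrib[symmetric])
    qed
    ultimately show ?thesis
      using Lim_transform_eventually by fastforce
  qed
  have img: "finite (T N ` A N)" "card (T N ` A N) = N" "finite (T N ` B N)" "card (T N ` B N) = N"
    if "N \<ge> 1" for N
    using fin[OF that] card_image[OF inj_on_subset[OF T(2) subset_UNIV]] by auto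
  have "(\<lambda>N. card {z \<in> T N ` A N. \<not> cell (sqrt N) z \<subseteq> limit_A \<beta>} / real N) \<longlonglongrightarrow> 0"
    by (rule tendsto_sandwich[OF _ _ tendsto_const bA_lim])
      (use evK in \<open>auto elim!: eventually_mono intro!: divide_right_mono TA\<close>)
  then have "weak_star_convergent (\<lambda>N. empirical_measure (T N ` A N)) (lebesgue_restricted (limit_A \<beta>))"
    unfolding ab(4) using ab(1-3) img by (intro weak_star_convergent_of_rectangle) auto
  moreover have "(\<lambda>N. card {z \<in> T N ` B N. \<not> cell (sqrt N) z \<subseteq> limit_B \<beta>} / real N) \<longlonglongrightarrow> 0"
    by (rule tendsto_sandwich[OF _ _ tendsto_const bB_lim])
      (use evK in \<open>auto elim!: eventually_mono intro!: divide_right_mono TB\<close>)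
  then have "weak_star_convergent (\<lambda>N. empirical_measure (T N ` B N)) (lebesgue_restricted (limit_B \<beta>))"
    unfolding ab(5) using ab(1-3) img by (intro weak_star_convergent_of_rectangle) auto
  ultimately show ?thesis using T by blast
qed

theorem corollary1p2:
  fixes \<beta> :: real and A B :: "nat \<Rightarrow> lattice set"
  assumes "0 < \<beta>" "\<beta> < 1" "\<beta> \<le> 1 / 2"
    and "\<And>N. N \<ge> 1 \<Longrightarrow> double_bubble_solution \<beta> N (A N) (B N)"
  shows "\<exists>T :: nat \<Rightarrow> lattice \<Rightarrow> lattice.
    (\<forall>N\<ge>1. T N \<in> lattice_isometries) \<and>
    weak_star_convergent (\<lambda>N. empirical_measure (T N ` A N)) (lebesgue_restricted (limit_A \<beta>)) \<and>
    weak_star_convergent (\<lambda>N. empirical_measure (T N ` B N)) (lebesgue_restricted (limit_B \<beta>))"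
proof -
  let ?rot = "\<lambda>(x1, x2). (- x2, x1) :: lattice"
  let ?orient = "\<lambda>A B :: lattice set.
      card (fst ` A \<inter> fst ` B) * (card (snd ` A) + card (snd ` B))
      \<le> card (snd ` A \<inter> snd ` B) * (card (fst ` A) + card (fst ` B))"
  \<comment> \<open>If the overlap of the first projections is the larger one in relative terms,
    a rotation by a right angle exchanges the roles of the coordinates.\<close>
  have "\<exists>S. S \<in> lattice_isometries \<and> (N \<ge> 1 \<longrightarrow> admissible N (S ` A N) (S ` B N)
      \<and> P \<beta> (S ` A N) (S ` B N) = P \<beta> (A N) (B N) \<and> ?orient (S ` A N) (S ` B N))" for N
  proof (cases "N \<ge> 1 \<and> \<not> ?orient (A N) (B N)")
    case False
    then show ?thesis
      using assms(4)[of N] lattice_isometries.translation[of 0]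
      by (intro exI[of _ "\<lambda>z. z + 0"]) (auto simp: double_bubble_solution_def is_arg_min_def)
  next
    case True
    have inj: "inj ?rot" by (auto simp: inj_on_def)
    have adm: "admissible N (A N) (B N)"
      using True assms(4)[of N] by (auto simp: double_bubble_solution_def is_arg_min_def)
    then have "admissible N (?rot ` A N) (?rot ` B N)"
      using inj by (auto simp: admissible_def card_image[OF inj_on_subset[OF inj subset_UNIV]]
          simp flip: image_Int[OF inj])
    moreover have fst: "fst ` ?rot ` V = uminus ` snd ` V" and snd: "snd ` ?rot ` V = fst ` V" for V
      by (force simp: image_image split_beta)+
    have "?orient (?rot ` A N) (?rot ` B N)"
      unfolding fst snd using True
      by (simp add: card_image image_Int[symmetric])
    ultimately show ?thesis
      using lattice_isometries.rotation P_rotation by blast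
  qed
  then obtain S where S: "\<And>N. S N \<in> lattice_isometries"
    "\<And>N. N \<ge> 1 \<Longrightarrow> admissible N (S N ` A N) (S N ` B N)"
    "\<And>N. N \<ge> 1 \<Longrightarrow> P \<beta> (S N ` A N) (S N ` B N) = P \<beta> (A N) (B N)"
    "\<And>N. N \<ge> 1 \<Longrightarrow> ?orient (S N ` A N) (S N ` B N)"
    by metis
  have "P \<beta> (S N ` A N) (S N ` B N) \<le> 4 * sqrt (4 - 2 * \<beta>) * sqrt N + 8" if "N \<ge> 1" for N
    using P_solution_le[OF assms(4)] S(3) that assms by simp
  from weak_star_convergence_of_oriented_pairs[of \<beta> "\<lambda>N. S N ` A N" "\<lambda>N. S N ` B N",
      OF assms(1,3) S(2) this S(4)]
  obtain T where T: "\<And>N. T N \<in> lattice_isometries"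
    "weak_star_convergent (\<lambda>N. empirical_measure (T N ` S N ` A N)) (lebesgue_restricted (limit_A \<beta>))"
    "weak_star_convergent (\<lambda>N. empirical_measure (T N ` S N ` B N)) (lebesgue_restricted (limit_B \<beta>))"
    by auto
  show ?thesis
    using T(2,3) lattice_isometries.comp[OF T(1) S(1)]
    by (intro exI[of _ "\<lambda>N. T N \<circ> S N"]) (simp add: image_comp)
qed

end
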